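(* Let $h,r>0$ with $\frac{h}{r}\le \omega$. For every $c\ge 0$ the functional $\mathcal E_c$ admits at least one minimizer on $X$. Moreover, any minimizer $\rho_c$ of $\mathcal E_c$ on $X$ satisfies: (a) $\rho_c$ is even; (b) $\rho_c$ is strictly convex; (c) $\rho_0<\rho_c<r$ on $(-h,h)$ for every $c>0$; (d) $\rho_c\to r$ uniformly on $[-h,h]$ as $c\to+\infty$ (i.e. for any sequence $c_j\to+\infty$ and any choice of minimizers $\rho_{c_j}$ of $\mathcal E_{c_j}$, $\rho_{c_j}\to r$ uniformly); (e) $\rho_c\in C^2([-h,h])$ and $\rho_c$ satisfies the Euler–Lagrange equation $$(1+(\rho')^2)\big((c+\rho^2)(\rho')^2+\rho^2\big)=\rho\rho''\big(\rho^2(\rho')^2+c(2-(\rho')^2)+\rho^2\big)$$ on $[-h,h]$, together with the first integral $$c\frac{(\rho_c')^2}{\rho_c(1+(\rho_c')^2)^{3/2}}-\frac{\rho_c}{\sqrt{1+(\rho_c')^2}}=-\rho_c(0)\quad\text{on }[-h,h].$$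
   Context: Fix $h,r>0$. Let $X=\{\rho\in W^{1,1}(-h,h):\ \rho>0 \text{ on }[-h,h],\ \rho(-h)=\rho(h)=r\}$ (elements of $W^{1,1}(-h,h)$ are identified with their continuous representatives). For $c\ge 0$, $\mathcal E_c:X\to\mathbb R$ is $$\mathcal E_c(\rho)=\int_{-h}^h\left(\rho\sqrt{1+(\rho')^2}+c\frac{(\rho')^2}{\rho\sqrt{1+(\rho')^2}}\right)dx.$$ Let $\Xi$ be the unique positive solution of $\xi\tanh\frac1\xi+\mathrm{sech}^2\frac1\xi=\xi$, and $\omega=\frac{1}{\Xi\cosh(1/\Xi)}$ (numerically $0.52<\omega<0.53$). Under $h/r\le\omega$, let $\Pi_0>0$ be the largest solution of $r=\Pi\cosh\frac{h}{\Pi}$ and $\rho_0(x)=\Pi_0\cosh\frac{x}{\Pi_0}$ on $[-h,h]$ (the catenary). *)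

theory Defs
  imports "HOL-Analysis.Analysis"
begin

definition Xi :: real where
  "Xi = (THE \<xi>. \<xi> > 0 \<and> \<xi> * tanh (1 / \<xi>) + 1 / (cosh (1 / \<xi>))\<^sup>2 = \<xi>)"

definition omega :: real where
  "omega = 1 / (Xi * cosh (1 / Xi))"

definition Pi0 :: "real \<Rightarrow> real \<Rightarrow> real" where
  "Pi0 h r = (GREATEST P. P > 0 \<and> r = P * cosh (h / P))"

definition rho0 :: "real \<Rightarrow> real \<Rightarrow> real \<Rightarrow> real" where
  "rho0 h r x = Pi0 h r * cosh (x / Pi0 h r)"

text \<open>W^{1,1}(-h,h) (continuous representative): rho is the indefinite integral of an
  L^1 function g (its weak derivative) on [-h,h].\<close>
definition W11_deriv :: "real \<Rightarrow> (real \<Rightarrow> real) \<Rightarrow> (real \<Rightarrow> real) \<Rightarrow> bool" where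
  "W11_deriv h \<rho> g \<longleftrightarrow> g absolutely_integrable_on {-h..h} \<and>
     (\<forall>x\<in>{-h..h}. \<rho> x = \<rho> (-h) + integral {-h..x} g)"

definition W11 :: "real \<Rightarrow> (real \<Rightarrow> real) \<Rightarrow> bool" where
  "W11 h \<rho> \<longleftrightarrow> (\<exists>g. W11_deriv h \<rho> g)"

text \<open>The weak derivative (unique up to null sets, which does not affect integrals).\<close>
definition wderiv :: "real \<Rightarrow> (real \<Rightarrow> real) \<Rightarrow> real \<Rightarrow> real" where
  "wderiv h \<rho> = (SOME g. W11_deriv h \<rho> g)"

definition Xset :: "real \<Rightarrow> real \<Rightarrow> (real \<Rightarrow> real) set" where
  "Xset h r = {\<rho>. W11 h \<rho> \<and> (\<forall>x\<in>{-h..h}. \<rho> x > 0) \<and> \<rho> (-h) = r \<and> \<rho> h = r}"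

definition Energy :: "real \<Rightarrow> real \<Rightarrow> (real \<Rightarrow> real) \<Rightarrow> real" where
  "Energy h c \<rho> = integral {-h..h} (\<lambda>x.
      \<rho> x * sqrt (1 + (wderiv h \<rho> x)\<^sup>2)
      + c * (wderiv h \<rho> x)\<^sup>2 / (\<rho> x * sqrt (1 + (wderiv h \<rho> x)\<^sup>2)))"

definition is_minimizer :: "real \<Rightarrow> real \<Rightarrow> real \<Rightarrow> (real \<Rightarrow> real) \<Rightarrow> bool" where
  "is_minimizer h r c \<rho> \<longleftrightarrow> \<rho> \<in> Xset h r \<and> (\<forall>\<sigma>\<in>Xset h r. Energy h c \<rho> \<le> Energy h c \<sigma>)"

definition strictly_convex_on :: "real set \<Rightarrow> (real \<Rightarrow> real) \<Rightarrow> bool" where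
  "strictly_convex_on S f \<longleftrightarrow> (\<forall>x\<in>S. \<forall>y\<in>S. \<forall>t. x \<noteq> y \<and> 0 < t \<and> t < 1 \<longrightarrow>
      f (t * x + (1 - t) * y) < t * f x + (1 - t) * f y)"

end

(* The Lagrangian f(s,p) = s sqrt(1+p^2) + c p^2 / (s sqrt(1+p^2)) is not convex in p, but for
   0 < a <= s the line through (0,a) that supports f(s,.) on p >= 0 touches it at exactly one
   slope, the root of the first integral f - p f_p = a. If phi_a(s) is the gradient of that line
   and rho is a competitor with minimum a, then f(rho,rho') >= a + phi_a(rho) |rho'|, so
   E_c(rho) >= val(a) := 2 h a + 2 int_a^r phi_a, with equality iff |rho'| is the contact slope
   almost everywhere and rho decreases to a and then increases. Minimizing E_c thus reduces to
   minimizing the function val of one real variable on (0,r]. Its derivative is 2 (h - X(a)),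
   where X(a) is the half-width of the extremal of height a, so at a minimum the extremal fits into
   [-h,h] and is the only competitor that attains val(a). For c = 0 everything is explicit, and
   h/r <= omega says that val for c = 0 has on (0,Pi0] its minimum at Pi0. For c > 0 the difference
   of the two value functions is nonincreasing in a and X is larger, which places every minimum
   strictly above Pi0. *)
theory Submission
  imports Defs
begin

section \<open>The Lagrangian and its supporting lines\<close>

text \<open>The Lagrangian grows only linearly, so minimizing sequences need not be compact in
  W^{1,1}, and for \<open>c > 0\<close> it may lose convexity in \<open>p\<close>. Their intercept
  must be the same number \<open>a\<close> at every height: then it integrates to
  \<open>2 h a\<close> for every competitor, while \<open>phi c a (\<rho>) \<rho>'\<close> is an
  exact derivative. The obstacle is the bottom of the curve. There the contact slope behaves like
  the square root of \<open>s - a\<close>, so extremals are parametrized by their slope, in which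
  abscissa and height are smooth, and \<open>val\<close> is handled by one-sided difference
  quotients instead of differentiation under the integral. The equation
  \<open>\<rho>' = slope\<close> has no uniqueness at height \<open>a\<close> either: a competitor
  could rest there. This is excluded because the two legs of the extremal already use up all of
  \<open>[-h, h]\<close>. The constant \<open>omega\<close> is the value of \<open>h / r\<close> at
  which, for \<open>c = 0\<close>, the catenary and the Goldschmidt configuration (two discs joined
  by a segment) have the same energy \<open>r^2\<close>.\<close>

definition lagr :: "real \<Rightarrow> real \<Rightarrow> real \<Rightarrow> real" where
  "lagr c s p = s * sqrt (1 + p\<^sup>2) + c * p\<^sup>2 / (s * sqrt (1 + p\<^sup>2))"

definition lagr_p :: "real \<Rightarrow> real \<Rightarrow> real \<Rightarrow> real" where
  "lagr_p c s p = s * p / sqrt (1 + p\<^sup>2) + c * (2 * p + p^3) / (s * sqrt (1 + p\<^sup>2) ^ 3)"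

text \<open>This is \<open>f - p f_p\<close>, conserved along extremals because the Lagrangian does
  not depend on \<open>x\<close>. At a minimum, where \<open>p = 0\<close>, it equals the height.
  The sign is opposite to that of the first integral in the theorem.\<close>

definition first_int :: "real \<Rightarrow> real \<Rightarrow> real \<Rightarrow> real" where
  "first_int c s p = s / sqrt (1 + p\<^sup>2) - c * p\<^sup>2 / (s * sqrt (1 + p\<^sup>2) ^ 3)"

text \<open>Discriminant of \<open>s^2 - a w s - c p^2 / w^2 = 0\<close> with
  \<open>w = sqrt (1 + p^2)\<close>, which is \<open>first_int c s p = a\<close> multiplied by
  \<open>s w\<close>.\<close>

definition discr :: "real \<Rightarrow> real \<Rightarrow> real \<Rightarrow> real" where
  "discr c a p = a\<^sup>2 * (1 + p\<^sup>2) + 4 * c * p\<^sup>2 / (1 + p\<^sup>2)"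

text \<open>\<open>ht c a p\<close> is the positive root \<open>s\<close> of the equation \<open>first_int c s p = a\<close>, which is quadratic
  in \<open>s\<close>: the extremal with minimum \<open>a\<close> has this height where its slope is \<open>p\<close>. Below, \<open>speed\<close> is
  \<open>dx / dp\<close> along this extremal.\<close>

definition ht :: "real \<Rightarrow> real \<Rightarrow> real \<Rightarrow> real" where
  "ht c a p = (a * sqrt (1 + p\<^sup>2) + sqrt (discr c a p)) / 2"

definition speed :: "real \<Rightarrow> real \<Rightarrow> real \<Rightarrow> real" where
  "speed c a p = (a / sqrt (1 + p\<^sup>2) + (a\<^sup>2 + 4 * c / (1 + p\<^sup>2)\<^sup>2) / sqrt (discr c a p)) / 2"

text \<open>Inverse of \<open>ht c a\<close> on \<open>p \<ge> 0\<close>. No such \<open>p\<close>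
  exists for \<open>s < a\<close>, where the value is unspecified; the facts below keep to heights
  \<open>\<ge> a\<close>.\<close>

definition slope :: "real \<Rightarrow> real \<Rightarrow> real \<Rightarrow> real" where
  "slope c a s = (THE p. 0 \<le> p \<and> ht c a p = s)"

definition phi :: "real \<Rightarrow> real \<Rightarrow> real \<Rightarrow> real" where
  "phi c a s = lagr_p c s (slope c a s)"

section \<open>Derivative and first integral of the Lagrangian\<close>

lemma sqrt_facts:
  fixes p :: real
  shows "sqrt (1 + p\<^sup>2) > 0" "sqrt (1 + p\<^sup>2) \<ge> 1" "(sqrt (1 + p\<^sup>2))\<^sup>2 = 1 + p\<^sup>2" "1 + p\<^sup>2 > 0"
    "sqrt (1 + p\<^sup>2) > \<bar>p\<bar>" "sqrt (1 + p\<^sup>2) \<le> 1 + p\<^sup>2"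
proof -
  show "1 + p\<^sup>2 > 0" by (simp add: add_pos_nonneg)
  then show "sqrt (1 + p\<^sup>2) > 0" "(sqrt (1 + p\<^sup>2))\<^sup>2 = 1 + p\<^sup>2" by simp_all
  show g1: "sqrt (1 + p\<^sup>2) \<ge> 1" by simp
  show "sqrt (1 + p\<^sup>2) > \<bar>p\<bar>"
    by (rule real_less_rsqrt) simp
  show "sqrt (1 + p\<^sup>2) \<le> 1 + p\<^sup>2"
    using mult_left_mono[OF g1, of "sqrt (1+p\<^sup>2)"] \<open>1 + p\<^sup>2 > 0\<close> by simp
qed

lemma sqrt_one_plus_has_derivative:
  "((\<lambda>p::real. sqrt (1 + p\<^sup>2)) has_real_derivative p / sqrt (1 + p\<^sup>2)) (at p)"
  using sqrt_facts(4)[of p] by (auto intro!: derivative_eq_intros simp: field_simps)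

lemma lagr_first_int: "s \<noteq> 0 \<Longrightarrow> first_int c s p = lagr c s p - p * lagr_p c s p"
proof -
  assume s: "s \<noteq> 0"
  define w where "w = sqrt (1 + p\<^sup>2)"
  have w: "w > 0" "w\<^sup>2 = 1 + p\<^sup>2" using sqrt_facts[of p] by (auto simp: w_def)
  have e: "s * w - p * (s * p / w) = s / w"
    using w by (simp add: field_simps power2_eq_square)
  have "c * p\<^sup>2 / (s * w) - p * (c * (2 * p + p^3) / (s * w^3)) = c * p\<^sup>2 * (w\<^sup>2 - 2 - p\<^sup>2) / (s * w^3)"
    using w(1) s by (simp add: field_simps power2_eq_square power3_eq_cube)
  also have "w\<^sup>2 - 2 - p\<^sup>2 = -1" using w by simp
  finally show ?thesis using e
    unfolding first_int_def lagr_def lagr_p_def w_def[symmetric] by (simp add: algebra_simps)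
qed

lemma lagr_has_derivative:
  assumes "s \<noteq> 0"
  shows "(lagr c s has_real_derivative lagr_p c s p) (at p)"
proof -
  define w where "w = sqrt (1 + p\<^sup>2)"
  have w: "w > 0" "w\<^sup>2 = 1 + p\<^sup>2" "1 + p\<^sup>2 > 0" using sqrt_facts[of p] by (auto simp: w_def)
  have "(lagr c s has_real_derivative
      s * (p / w) + (2 * c * p * (s * w) - c * p\<^sup>2 * (s * (p / w))) / (s * w)\<^sup>2) (at p)"
  proof -
    have W: "((\<lambda>p. sqrt (1 + p\<^sup>2)) has_real_derivative p / w) (at p)"
      unfolding w_def by (rule sqrt_one_plus_has_derivative)
    have N: "((\<lambda>p. c * p\<^sup>2) has_real_derivative 2 * c * p) (at p)"
      by (auto intro!: derivative_eq_intros)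
    show ?thesis
      using DERIV_add[OF DERIV_cmult[OF W, of s] DERIV_quotient[OF N DERIV_cmult[OF W, of s]]] w(1) assms
      by (simp add: lagr_def [abs_def] w_def numeral_2_eq_2 mult_ac)
  qed
  moreover have "(2 * c * p * (s * w) - c * p\<^sup>2 * (s * (p / w))) / (s * w)\<^sup>2 = c * p * (2 * w\<^sup>2 - p\<^sup>2) / (s * w^3)"
    using w(1) assms by (simp add: field_simps power2_eq_square power3_eq_cube)
  moreover have "p * (2 * w\<^sup>2 - p\<^sup>2) = 2 * p + p^3"
    unfolding w(2) by (simp add: algebra_simps power2_eq_square power3_eq_cube)
  ultimately show ?thesis
    unfolding lagr_p_def w_def[symmetric] by (simp add: mult.assoc)
qed

text \<open>In the sine \<open>v\<close> of the inclination angle the derivative is a cubic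
  polynomial. The part \<open>2 v - v^3\<close> decreases for \<open>v^2 > 2/3\<close>, that is for
  \<open>p^2 > 2\<close>; only there can convexity fail.\<close>

lemma lagr_p_eq:
  assumes "s > 0"
  defines "v \<equiv> \<lambda>p. p / sqrt (1 + p\<^sup>2)"
  shows "lagr_p c s p = s * v p + c / s * (2 * v p - v p ^ 3)"
proof -
  define w where "w = sqrt (1 + p\<^sup>2)"
  have w: "w > 0" "w\<^sup>2 = 1 + p\<^sup>2" "1 + p\<^sup>2 > 0" using sqrt_facts[of p] by (auto simp: w_def)
  have *: "2 * p + p^3 = p * (2 * w\<^sup>2 - p\<^sup>2)"
    unfolding w(2) by (simp add: algebra_simps power2_eq_square power3_eq_cube)
  have "(2 * p + p^3) / w^3 = 2 * (p / w) - (p / w)^3"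
    unfolding * using w(1) by (simp add: field_simps power2_eq_square power3_eq_cube)
  moreover have "lagr_p c s p = s * (p / w) + c / s * ((2 * p + p^3) / w^3)"
    by (simp add: lagr_p_def w_def)
  ultimately show ?thesis by (simp add: v_def w_def)
qed

section \<open>Height and slope along an extremal\<close>

context
  fixes c a :: real
  assumes c: "c \<ge> 0" and a: "a > 0"
begin

lemma discr_pos: "discr c a p > 0"
  unfolding discr_def using a c sqrt_facts(4)[of p]
  by (intro add_pos_nonneg mult_pos_pos divide_nonneg_pos) auto

lemma ht_ge: "ht c a p \<ge> a * sqrt (1 + p\<^sup>2)"
proof -
  have "a * sqrt (1 + p\<^sup>2) = sqrt (a\<^sup>2 * (1 + p\<^sup>2))"
    using a by (simp add: real_sqrt_mult)
  also have "\<dots> \<le> sqrt (discr c a p)"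
    unfolding discr_def using c sqrt_facts(4)[of p] by (intro real_sqrt_le_mono) simp
  finally show ?thesis unfolding ht_def by simp
qed

lemma ht_ge_a: "ht c a p \<ge> a"
  using order_trans[OF _ ht_ge[of p], of "a * 1"] mult_left_mono[OF sqrt_facts(2)[of p], of a] a
  by (simp del: real_sqrt_ge_1_iff mult_le_cancel_left_pos)

lemma ht_pos: "ht c a p > 0"
  using ht_ge_a[of p] a by linarith

lemma ht_0 [simp]: "ht c a 0 = a"
  unfolding ht_def discr_def using a by simp

lemma ht_minus [simp]: "ht c a (- p) = ht c a p"
  by (simp add: ht_def discr_def)

lemma ht_quadratic: "(ht c a p)\<^sup>2 = a * sqrt (1 + p\<^sup>2) * ht c a p + c * p\<^sup>2 / (1 + p\<^sup>2)"
proof -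
  define w where "w = sqrt (1 + p\<^sup>2)"
  have w: "w > 0" "w\<^sup>2 = 1 + p\<^sup>2" "1 + p\<^sup>2 > 0" using sqrt_facts[of p] by (auto simp: w_def)
  have S: "ht c a p = (a * w + sqrt (discr c a p)) / 2" by (simp add: ht_def w_def)
  have "(2 * ht c a p - a * w)\<^sup>2 = discr c a p"
    using discr_pos[of p] by (simp add: S add_divide_distrib)
  then have "4 * (ht c a p)\<^sup>2 - 4 * (a * w * ht c a p) + a\<^sup>2 * w\<^sup>2 = discr c a p"
    by (simp add: power2_eq_square algebra_simps)
  then show ?thesis unfolding discr_def w(2) w_def[symmetric] by simp
qed

text \<open>Multiplied by \<open>s sqrt (1 + p^2)\<close>, the left side is a monic quadratic in
  \<open>s\<close>. One root is \<open>ht c a p\<close>, the other, by Vieta, is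
  \<open>- c p^2 / ((1 + p^2) ht c a p) \<le> 0\<close>. So for \<open>s > 0\<close> the sign is
  that of \<open>s - ht c a p\<close>.\<close>

lemma first_int_minus:
  assumes "s > 0"
  shows "first_int c s p - a =
    (s - ht c a p) * ((s + c * p\<^sup>2 / ((1 + p\<^sup>2) * ht c a p)) / (s * sqrt (1 + p\<^sup>2)))"
proof -
  define w where "w = sqrt (1 + p\<^sup>2)"
  define S where "S = ht c a p"
  have w: "w > 0" "w\<^sup>2 = 1 + p\<^sup>2" "1 + p\<^sup>2 > 0" using sqrt_facts[of p] by (auto simp: w_def)
  have S: "S > 0" "S\<^sup>2 = a * w * S + c * p\<^sup>2 / w\<^sup>2"
    using ht_pos[of p] ht_quadratic[of p] w(2) by (auto simp: S_def w_def)
  then have q: "c * p\<^sup>2 / w\<^sup>2 = S * (S - a * w)" by (simp add: power2_eq_square algebra_simps)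
  have "c * p\<^sup>2 / (w\<^sup>2 * S) = (c * p\<^sup>2 / w\<^sup>2) / S" by simp
  also have "\<dots> = S - a * w" unfolding q using S(1) by simp
  finally have e1: "c * p\<^sup>2 / (w\<^sup>2 * S) = S - a * w" .
  have "c * p\<^sup>2 / (s * w ^ 3) = (c * p\<^sup>2 / w\<^sup>2) / (s * w)"
    using w(1) assms by (simp add: field_simps power2_eq_square power3_eq_cube)
  also have "\<dots> = S * (S - a * w) / (s * w)" unfolding q ..
  finally have e2: "c * p\<^sup>2 / (s * w ^ 3) = S * (S - a * w) / (s * w)" .
  have "first_int c s p = s / w - S * (S - a * w) / (s * w)"
    unfolding first_int_def w_def[symmetric] e2 ..
  moreover have "s / w - S * (S - a * w) / (s * w) - a = (s - S) * ((s + (S - a * w)) / (s * w))"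
    using assms w(1) by (simp add: field_simps)
  ultimately show ?thesis
    using e1 by (simp add: S_def w_def w(2))
qed

lemma first_int_factor_pos:
  assumes "s > 0"
  shows "(s + c * p\<^sup>2 / ((1 + p\<^sup>2) * ht c a p)) / (s * sqrt (1 + p\<^sup>2)) > 0"
  using assms c ht_pos[of p] sqrt_facts[of p]
  by (intro divide_pos_pos add_pos_nonneg mult_pos_pos divide_nonneg_pos) auto

lemma first_int_ht: "first_int c (ht c a p) p = a"
  using first_int_minus[OF ht_pos, of p p] by simp

lemma first_int_gt: "s > 0 \<Longrightarrow> first_int c s p > a \<longleftrightarrow> s > ht c a p"
  using first_int_minus[of s p] first_int_factor_pos[of s p] zero_less_mult_iff[of "s - ht c a p"]
  by (metis diff_gt_0_iff_gt less_asym)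

lemma first_int_lt: "s > 0 \<Longrightarrow> first_int c s p < a \<longleftrightarrow> s < ht c a p"
  using first_int_minus[of s p] first_int_factor_pos[of s p] mult_less_0_iff[of "s - ht c a p"]
  by (metis diff_less_0_iff_less less_asym)

lemma speed_pos: "speed c a p > 0"
proof -
  have "a / sqrt (1 + p\<^sup>2) > 0"
    using a sqrt_facts(1)[of p] by (rule divide_pos_pos)
  moreover have "4 * c / (1 + p\<^sup>2)\<^sup>2 \<ge> 0" using c by simp
  then have "(a\<^sup>2 + 4 * c / (1 + p\<^sup>2)\<^sup>2) / sqrt (discr c a p) > 0"
    using a discr_pos[of p] by (intro divide_pos_pos add_pos_nonneg) simp_all
  ultimately show ?thesis unfolding speed_def by simp
qed

lemma speed_minus: "speed c a (- p) = speed c a p"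
  by (simp add: speed_def discr_def)

lemma continuous_on_speed: "continuous_on S (speed c a)"
proof -
  have *: "\<forall>x\<in>S. 1 + x\<^sup>2 \<noteq> 0" "\<forall>x\<in>S. sqrt (1 + x\<^sup>2) \<noteq> 0" "\<forall>x\<in>S. (1 + x\<^sup>2)\<^sup>2 \<noteq> 0"
    using sqrt_facts(1,4) by (metis less_irrefl zero_less_power)+
  have **: "\<forall>x\<in>S. sqrt (discr c a x) \<noteq> 0"
    using discr_pos by (metis less_irrefl real_sqrt_gt_zero)
  have ***: "continuous_on S (\<lambda>x. discr c a x)"
    unfolding discr_def by (intro continuous_intros *)
  show ?thesis
    unfolding speed_def [abs_def] by (intro continuous_intros * ** ***) simp_all
qed

text \<open>This is \<open>ds/dp = (ds/dx) (dx/dp)\<close> with \<open>ds/dx = p\<close>. The factor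
  \<open>p\<close> makes the inverse function \<open>slope\<close> singular at \<open>s = a\<close>,
  whereas \<open>speed\<close> stays positive at \<open>p = 0\<close>.\<close>

lemma ht_has_derivative: "(ht c a has_real_derivative p * speed c a p) (at p)"
proof -
  define w where "w = sqrt (1 + p\<^sup>2)"
  have w: "w > 0" "w\<^sup>2 = 1 + p\<^sup>2" "1 + p\<^sup>2 > 0" using sqrt_facts[of p] by (auto simp: w_def)
  have "(discr c a has_real_derivative
      a\<^sup>2 * (2 * p) + (8 * c * p * (1 + p\<^sup>2) - 4 * c * p\<^sup>2 * (2 * p)) / (1 + p\<^sup>2)\<^sup>2) (at p)"
    unfolding discr_def [abs_def] using w(3)
    by (auto intro!: derivative_eq_intros simp: power2_eq_square)
  also have "(8 * c * p * (1 + p\<^sup>2) - 4 * c * p\<^sup>2 * (2 * p)) = 8 * c * p"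
    by (simp add: algebra_simps power2_eq_square)
  finally have D: "(discr c a has_real_derivative 2 * p * (a\<^sup>2 + 4 * c / (1 + p\<^sup>2)\<^sup>2)) (at p)"
    by (simp add: algebra_simps)
  have D2: "((\<lambda>p. sqrt (discr c a p)) has_real_derivative
      p * (a\<^sup>2 + 4 * c / (1 + p\<^sup>2)\<^sup>2) / sqrt (discr c a p)) (at p)"
    using DERIV_chain2[OF DERIV_real_sqrt[OF discr_pos] D]
    by (rule DERIV_cong) (use discr_pos[of p] in \<open>simp add: field_simps\<close>)
  have "(ht c a has_real_derivative
      (a * (p / w) + p * (a\<^sup>2 + 4 * c / (1 + p\<^sup>2)\<^sup>2) / sqrt (discr c a p)) / 2) (at p)"
    unfolding ht_def [abs_def] w_def
    by (intro DERIV_cdivide DERIV_add DERIV_cmult sqrt_one_plus_has_derivative D2)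
  then show ?thesis
    by (rule DERIV_cong) (simp add: speed_def w_def algebra_simps)
qed

lemma continuous_on_ht: "continuous_on S (ht c a)"
  by (meson DERIV_continuous_on ht_has_derivative has_field_derivative_at_within)

lemma ht_strict_mono:
  assumes "0 \<le> p" "p < q"
  shows "ht c a p < ht c a q"
proof (rule DERIV_pos_imp_increasing_open[OF assms(2)])
  fix x assume "p < x" "x < q"
  then show "\<exists>y. DERIV (ht c a) x :> y \<and> y > 0"
    using assms ht_has_derivative[of x] speed_pos[of x] by (intro exI[of _ "x * speed c a x"]) simp
qed (auto intro: continuous_on_ht)

lemma ht_inj: "0 \<le> p \<Longrightarrow> 0 \<le> q \<Longrightarrow> ht c a p = ht c a q \<Longrightarrow> p = q"
  using ht_strict_mono[of p q] ht_strict_mono[of q p] by (cases p q rule: linorder_cases) auto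

lemma ht_less_iff: "0 \<le> p \<Longrightarrow> 0 \<le> q \<Longrightarrow> ht c a p < ht c a q \<longleftrightarrow> p < q"
  using ht_strict_mono[of p q] ht_strict_mono[of q p] by (cases p q rule: linorder_cases) auto

lemma slope_ht: "0 \<le> p \<Longrightarrow> slope c a (ht c a p) = p"
  unfolding slope_def by (rule the_equality) (auto intro: ht_inj)

lemma slope_exists:
  assumes "a \<le> s"
  shows "\<exists>p\<ge>0. ht c a p = s"
proof -
  \<comment> \<open>The slope \<open>s / a\<close> is steep enough for the intermediate value
    theorem, since \<open>ht c a p \<ge> a |p|\<close>.\<close>
  have "ht c a (s / a) \<ge> a * sqrt (1 + (s / a)\<^sup>2)" by (rule ht_ge)
  moreover have "a * sqrt (1 + (s / a)\<^sup>2) \<ge> a * (s / a)"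
    using sqrt_facts(5)[of "s / a"] a by (intro mult_left_mono) linarith+
  ultimately have "s \<le> ht c a (s / a)" using a by simp
  then show ?thesis
    using IVT'[of "ht c a" 0 s "s / a"] assms a continuous_on_ht by auto
qed

lemma slope_props:
  assumes "a \<le> s"
  shows "0 \<le> slope c a s \<and> ht c a (slope c a s) = s"
proof -
  obtain p where "p \<ge> 0" "ht c a p = s" using slope_exists[OF assms] by auto
  then show ?thesis using slope_ht[of p] by simp
qed

lemmas slope_nonneg = slope_props[THEN conjunct1]
  and ht_slope = slope_props[THEN conjunct2]

lemma slope_a [simp]: "slope c a a = 0"
  using slope_ht[of 0] by simp

lemma slope_less_iff: "a \<le> s \<Longrightarrow> a \<le> t \<Longrightarrow> slope c a s < slope c a t \<longleftrightarrow> s < t"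
  using ht_less_iff[of "slope c a s" "slope c a t"] by (simp add: ht_slope slope_nonneg)

lemma slope_pos: "a < s \<Longrightarrow> 0 < slope c a s"
  using slope_less_iff[of a s] by simp

lemma continuous_on_slope: "continuous_on {a..} (slope c a)"
proof -
  \<comment> \<open>Continuity of an inverse is available on images of compact sets, hence the
    exhaustion by \<open>{a..<t}\<close>; the pieces are open at the right so that each is a
    neighbourhood of its points within \<open>{a..}\<close>.\<close>
  have *: "continuous_on {a..<t} (slope c a)" if "a < t" for t
  proof -
    have "continuous_on (ht c a ` {0..slope c a t}) (slope c a)"
      by (rule continuous_on_inv) (auto intro: continuous_on_ht simp: slope_ht)
    moreover have "{a..<t} \<subseteq> ht c a ` {0..slope c a t}"
    proof
      fix s assume s: "s \<in> {a..<t}"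
      have "s = ht c a (slope c a s)" using s ht_slope by auto
      moreover have "slope c a s \<in> {0..slope c a t}"
        using s that slope_nonneg[of s] slope_less_iff[of s t] by auto
      ultimately show "s \<in> ht c a ` {0..slope c a t}" by blast
    qed
    ultimately show ?thesis by (rule continuous_on_subset)
  qed
  have "continuous (at s within {a..}) (slope c a)" if "s \<ge> a" for s
  proof -
    have "continuous (at s within {a..<s+1}) (slope c a)"
      using *[of "s+1"] that by (auto simp: continuous_on_eq_continuous_within)
    moreover have "at s within {a..<s+1} = at s within {a..}"
      by (rule at_within_nhd[of _ "{..<s+1}"]) auto
    ultimately show ?thesis by simp
  qed
  then show ?thesis by (auto simp: continuous_on_eq_continuous_within)
qed

section \<open>Contact and support of the lines through \<open>(0, a)\<close>\<close>

lemma lagr_slope: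
  assumes "a \<le> s"
  shows "lagr c s (slope c a s) = a + phi c a s * slope c a s"
proof -
  have "first_int c s (slope c a s) = a"
    using first_int_ht[of "slope c a s"] ht_slope[OF assms] by simp
  then show ?thesis
    using lagr_first_int[of s c "slope c a s"] assms a by (simp add: phi_def algebra_simps)
qed

lemma phi_pos: "a < s \<Longrightarrow> phi c a s > 0"
proof -
  assume s: "a < s"
  define p where "p = slope c a s"
  have p: "p > 0" using slope_pos[OF s] by (simp add: p_def)
  have "s * p / sqrt (1 + p\<^sup>2) > 0"
    using s a p sqrt_facts(1)[of p] by (intro divide_pos_pos mult_pos_pos) auto
  moreover have "c * (2 * p + p^3) / (s * sqrt (1 + p\<^sup>2) ^ 3) \<ge> 0"
    using s a p c sqrt_facts(1)[of p] by (intro divide_nonneg_pos mult_nonneg_nonneg mult_pos_pos) auto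
  ultimately show ?thesis unfolding phi_def lagr_p_def p_def by linarith
qed

lemma phi_a [simp]: "phi c a a = 0"
  by (simp add: phi_def lagr_p_def)

lemma phi_nonneg: "a \<le> s \<Longrightarrow> phi c a s \<ge> 0"
  using phi_pos[of s] phi_a by (cases "s = a") (simp_all del: phi_a)

lemma continuous_on_phi: "continuous_on {a..} (phi c a)"
proof -
  have *: "\<forall>s\<in>{a..}. sqrt (1 + (slope c a s)\<^sup>2) \<noteq> 0"
    using sqrt_facts(1) by (metis less_irrefl)
  have **: "\<forall>s\<in>{a..}. s * sqrt (1 + (slope c a s)\<^sup>2) ^ 3 \<noteq> 0"
  proof
    fix s assume "s \<in> {a..}"
    then have "s * sqrt (1 + (slope c a s)\<^sup>2) ^ 3 > 0"
      using a sqrt_facts(1) by (intro mult_pos_pos zero_less_power) auto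
    then show "s * sqrt (1 + (slope c a s)\<^sup>2) ^ 3 \<noteq> 0" by linarith
  qed
  have ***: "continuous_on {a..} (\<lambda>s. slope c a s)" using continuous_on_slope .
  show ?thesis
    unfolding phi_def [abs_def] lagr_p_def by (intro continuous_intros * ** ***)
qed

text \<open>The difference quotient \<open>(f - a) / p\<close> has derivative \<open>(a - I) / p\<^sup>2\<close>, where \<open>I\<close> is the
  first integral, and \<open>I - a\<close> changes sign exactly once. So the line through \<open>(0, a)\<close> of slope
  \<^term>\<open>phi c a s\<close> supports the Lagrangian even where the latter is not convex.\<close>

lemma lagr_gt:
  assumes s: "a \<le> s" and p: "0 \<le> p" and ne: "p \<noteq> slope c a s"
  shows "lagr c s p > a + phi c a s * p"
proof -
  have s0: "s > 0" using a s by simp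
  have cpos: "0 \<le> c * p\<^sup>2 / (s * sqrt (1 + p\<^sup>2))"
    using c s0 sqrt_facts[of p] by (intro divide_nonneg_pos) auto
  consider "s = a" | "s > a" "p = 0" | "s > a" "p > 0" using s p by linarith
  then show ?thesis
  proof cases
    case 1
    then have "p > 0" using ne p by simp
    then have "sqrt (1 + p\<^sup>2) > 1" by (simp add: real_less_rsqrt)
    then have "a * sqrt (1 + p\<^sup>2) > a" using a by simp
    then show ?thesis using 1 cpos unfolding lagr_def by simp
  next
    case 2
    then show ?thesis by (simp add: lagr_def)
  next
    case 3
    define q where "q = slope c a s"
    define G where "G = (\<lambda>p. (lagr c s p - a) / p)"
    have q: "q > 0" "ht c a q = s" using slope_pos ht_slope 3 by (auto simp: q_def)
    have Gd: "(G has_real_derivative (a - first_int c s x) / x\<^sup>2) (at x)" if "x > 0" for x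
      unfolding G_def using that s0 lagr_first_int[of s c x]
      by (auto intro!: derivative_eq_intros lagr_has_derivative simp: power2_eq_square algebra_simps)
    have Gc: "continuous_on {x..y} G" if "x > 0" for x y
      by (rule DERIV_continuous_on[where D = "\<lambda>x. (a - first_int c s x) / x\<^sup>2"])
         (use that in \<open>auto intro!: has_field_derivative_at_within[OF Gd]\<close>)
    have "G q < G p"
    proof (cases "p < q")
      case True
      show ?thesis
      proof (rule DERIV_neg_imp_decreasing_open[OF True])
        fix x assume x: "p < x" "x < q"
        then have "first_int c s x > a"
          using ht_strict_mono[of x q] q 3 first_int_gt[OF s0, of x] by simp
        then show "\<exists>y. DERIV G x :> y \<and> y < 0"
          using Gd[of x] x 3 by (intro exI[of _ "(a - first_int c s x) / x\<^sup>2"]) (auto simp: divide_less_0_iff)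
      qed (use Gc 3 in auto)
    next
      case False
      then have "q < p" using ne q_def by simp
      then show ?thesis
      proof (rule DERIV_pos_imp_increasing_open)
        fix x assume x: "q < x" "x < p"
        then have "first_int c s x < a"
          using ht_strict_mono[of q x] q 3 first_int_lt[OF s0, of x] by simp
        then show "\<exists>y. DERIV G x :> y \<and> y > 0"
          using Gd[of x] x q by (intro exI[of _ "(a - first_int c s x) / x\<^sup>2"]) (auto simp: zero_less_divide_iff)
      qed (use Gc q in auto)
    qed
    moreover have "G q = phi c a s"
      using lagr_slope[OF s] q by (simp add: G_def q_def)
    ultimately have "phi c a s < (lagr c s p - a) / p" by (simp add: G_def)
    then show ?thesis using 3 by (simp add: pos_less_divide_eq algebra_simps)
  qed
qed

lemma lagr_abs: "lagr c s \<bar>p\<bar> = lagr c s p"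
  by (simp add: lagr_def)

lemma lagr_ge: "a \<le> s \<Longrightarrow> lagr c s p \<ge> a + phi c a s * \<bar>p\<bar>"
  and lagr_eq_iff: "a \<le> s \<Longrightarrow> lagr c s p = a + phi c a s * \<bar>p\<bar> \<longleftrightarrow> \<bar>p\<bar> = slope c a s"
  using lagr_gt[of s "\<bar>p\<bar>"] lagr_slope[of s] lagr_abs[of s p]
  by (cases "\<bar>p\<bar> = slope c a s"; simp)+

text \<open>For \<open>s > a\<close> equality holds at the contact slope, so
  \<open>phi c a s\<close> is the minimum of these quotients. The later estimates that relate
  \<open>phi\<close> at different heights or different \<open>c\<close> all insert a test slope
  here.\<close>

lemma phi_le_quotient: "a \<le> s \<Longrightarrow> 0 < p \<Longrightarrow> phi c a s \<le> (lagr c s p - a) / p"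
  using lagr_ge[of s p] by (simp add: field_simps)

end

section \<open>The transit function of extremals\<close>

definition pos :: "real \<Rightarrow> real \<Rightarrow> real \<Rightarrow> real" where
  "pos c a p = integral {0..p} (speed c a) - integral {p..0} (speed c a)"

text \<open>\<open>pos c a p\<close> is the abscissa at which the extremal with minimum \<open>a\<close> at \<open>0\<close> has slope \<open>p\<close>; one of the
  two integrals is over an empty interval. \<open>transit c a s\<close> is the abscissa at which it has height \<open>s\<close>.\<close>

definition transit :: "real \<Rightarrow> real \<Rightarrow> real \<Rightarrow> real" where
  "transit c a s = pos c a (slope c a s)"

definition val :: "real \<Rightarrow> real \<Rightarrow> real \<Rightarrow> real \<Rightarrow> real" where
  "val h r c a = 2 * h * a + 2 * integral {a..r} (phi c a)"

lemma integral_le_const: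
  fixes f :: "real \<Rightarrow> real"
  assumes "f integrable_on {x..y}" "x \<le> y" "\<And>s. x \<le> s \<Longrightarrow> s \<le> y \<Longrightarrow> f s \<le> B"
  shows "integral {x..y} f \<le> B * (y - x)"
proof -
  have "integral {x..y} f \<le> integral {x..y} (\<lambda>_. B)"
    by (rule integral_le) (use assms in auto)
  then show ?thesis using assms(2) by (simp add: mult.commute)
qed

context
  fixes c a :: real
  assumes c: "c \<ge> 0" and a: "a > 0"
begin

lemma speed_integrable: "speed c a integrable_on {x..y}"
  by (rule integrable_continuous_real) (rule continuous_on_speed[OF c a])

lemma pos_has_derivative: "(pos c a has_real_derivative speed c a p) (at p)"
proof -
  \<comment> \<open>A base point \<open>-n\<close> to the left of both \<open>0\<close> and
    \<open>p\<close> turns the two cases of \<open>pos\<close> into one indefinite integral.\<close>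
  define n where "n = \<bar>p\<bar> + 1"
  have n: "-n < 0" "-n < p" "p < n" by (auto simp: n_def)
  have eq: "pos c a q = integral {-n..q} (speed c a) - integral {-n..0} (speed c a)"
    if "-n \<le> q" for q
  proof (cases "q \<ge> 0")
    case True
    have "integral {q..0} (speed c a) = 0"
      using True by (cases "q = 0") auto
    then show ?thesis
      using Henstock_Kurzweil_Integration.integral_combine[of "-n" 0 q "speed c a"] True n speed_integrable
      by (simp add: pos_def)
  next
    case False
    then show ?thesis
      using Henstock_Kurzweil_Integration.integral_combine[of "-n" q 0 "speed c a"] that speed_integrable
      by (simp add: pos_def)
  qed
  have "((\<lambda>q. integral {-n..q} (speed c a) - integral {-n..0} (speed c a))
      has_real_derivative speed c a p - 0) (at p within {-n..n})"
    using n by (intro DERIV_diff integral_has_real_derivative continuous_on_speed[OF c a] DERIV_const) auto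
  then have "((\<lambda>q. integral {-n..q} (speed c a) - integral {-n..0} (speed c a))
      has_real_derivative speed c a p) (at p)"
    using n by (simp add: at_within_Icc_at)
  then show ?thesis
    by (rule has_field_derivative_transform_within_open[where S = "{-n<..<n}"]) (use n eq in auto)
qed

lemma pos_0 [simp]: "pos c a 0 = 0"
  by (simp add: pos_def)

lemma continuous_on_pos: "continuous_on S (pos c a)"
  by (meson DERIV_continuous_on pos_has_derivative has_field_derivative_at_within)

lemma pos_strict_mono: "p < q \<Longrightarrow> pos c a p < pos c a q"
  by (rule DERIV_pos_imp_increasing) (use pos_has_derivative speed_pos[OF c a] in blast)+

lemma pos_less_iff: "pos c a p < pos c a q \<longleftrightarrow> p < q"
  using pos_strict_mono[of p q] pos_strict_mono[of q p] by (cases p q rule: linorder_cases) auto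

lemma pos_minus: "pos c a (- p) = - pos c a p"
  using Henstock_Kurzweil_Integration.integral_reflect_real[of 0 p "speed c a"]
    Henstock_Kurzweil_Integration.integral_reflect_real[of p 0 "speed c a"]
  by (simp add: pos_def speed_minus[OF c a])

lemma slope_has_derivative:
  assumes "a < s"
  shows "(slope c a has_real_derivative inverse (slope c a s * speed c a (slope c a s))) (at s)"
proof (rule DERIV_inverse_function)
  show "(ht c a has_real_derivative slope c a s * speed c a (slope c a s)) (at (slope c a s))"
    by (rule ht_has_derivative[OF c a])
  show "slope c a s * speed c a (slope c a s) \<noteq> 0"
    using slope_pos[OF c a assms] speed_pos[OF c a, of "slope c a s"] by simp
  show "a < s" "s < s + 1" using assms by auto
  show "ht c a (slope c a y) = y" if "a < y" "y < s + 1" for y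
    using ht_slope[OF c a] that by simp
  have "continuous_on {a<..} (slope c a)"
    by (rule continuous_on_subset[OF continuous_on_slope[OF c a]]) auto
  then show "isCont (slope c a) s"
    using assms by (simp add: continuous_on_eq_continuous_at)
qed

lemma transit_has_derivative:
  assumes "a < s"
  shows "(transit c a has_real_derivative 1 / slope c a s) (at s)"
proof -
  have "(transit c a has_real_derivative
      speed c a (slope c a s) * inverse (slope c a s * speed c a (slope c a s))) (at s)"
    unfolding transit_def [abs_def]
    by (rule DERIV_chain2[OF pos_has_derivative slope_has_derivative[OF assms]])
  then show ?thesis
    by (rule DERIV_cong) (use speed_pos[OF c a, of "slope c a s"] in \<open>simp add: field_simps\<close>)
qed

lemma continuous_on_transit: "continuous_on {a..} (transit c a)"
  unfolding transit_def [abs_def]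
  by (rule continuous_on_compose2[OF continuous_on_pos[of UNIV] continuous_on_slope[OF c a]]) auto

lemma transit_less_iff:
  "a \<le> s \<Longrightarrow> a \<le> t \<Longrightarrow> transit c a s < transit c a t \<longleftrightarrow> s < t"
  unfolding transit_def using pos_less_iff slope_less_iff[OF c a] by simp

lemma transit_a [simp]: "transit c a a = 0"
  using slope_a[OF c a] by (simp add: transit_def)

lemma transit_nonneg: "a \<le> s \<Longrightarrow> transit c a s \<ge> 0"
  using transit_less_iff[of a s] transit_a by (cases "s = a") simp_all

text \<open>The integrand is unbounded at \<open>a\<close>, so the lower end stays strictly above
  it. The estimates for \<open>val\<close> either let it tend to \<open>a\<close> or treat a short
  interval around \<open>a\<close> separately.\<close>

lemma transit_integral:
  assumes "a < x" "x \<le> y"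
  shows "((\<lambda>s. 1 / slope c a s) has_integral transit c a y - transit c a x) {x..y}"
proof (rule fundamental_theorem_of_calculus[OF assms(2)])
  fix s assume "s \<in> {x..y}"
  then show "(transit c a has_vector_derivative 1 / slope c a s) (at s within {x..y})"
    using transit_has_derivative[of s] assms(1)
    by (auto simp: has_real_derivative_iff_has_vector_derivative[symmetric]
        intro: has_field_derivative_at_within)
qed

lemma phi_integrable: "a \<le> x \<Longrightarrow> phi c a integrable_on {x..y}"
  by (rule integrable_continuous_real, rule continuous_on_subset[OF continuous_on_phi[OF c a]]) auto

lemma phi_integral_split:
  "a \<le> x \<Longrightarrow> x \<le> y \<Longrightarrow> y \<le> z \<Longrightarrow>
    integral {x..z} (phi c a) = integral {x..y} (phi c a) + integral {y..z} (phi c a)"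
  using Henstock_Kurzweil_Integration.integral_combine[of x y z "phi c a"] phi_integrable by simp

lemma phi_integral_nonneg: "a \<le> x \<Longrightarrow> integral {x..y} (phi c a) \<ge> 0"
  using phi_nonneg[OF c a] phi_integrable by (intro integral_nonneg) auto

text \<open>Test slope \<open>sqrt d\<close>. Where \<open>s - a\<close> is of order
  \<open>d\<close>, the bound is of order \<open>sqrt d\<close>, so an interval of length of order
  \<open>d\<close> next to \<open>a\<close> contributes only \<open>d sqrt d\<close> to the integral
  of \<open>phi\<close> and vanishes in difference quotients of \<open>val\<close>.\<close>

lemma phi_near_le:
  assumes "a \<le> s" "d > 0"
  shows "phi c a s \<le> (s - a + (s + c / s) * d) / sqrt d"
proof -
  have s: "s > 0" using a assms by simp
  have "c * d / (s * sqrt (1 + d)) \<le> c * d / (s * 1)"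
    using c s assms by (intro divide_left_mono mult_left_mono) auto
  moreover have "s * sqrt (1 + d) \<le> s * (1 + d)"
    using sqrt_facts(6)[of "sqrt d"] s assms by (intro mult_left_mono) auto
  ultimately have "lagr c s (sqrt d) \<le> s + (s + c / s) * d"
    using assms unfolding lagr_def by (simp add: algebra_simps)
  then have "(lagr c s (sqrt d) - a) / sqrt d \<le> (s - a + (s + c / s) * d) / sqrt d"
    using assms by (intro divide_right_mono) auto
  then show ?thesis
    using phi_le_quotient[OF c a assms(1), of "sqrt d"] assms(2) by simp
qed

end

section \<open>Comparison of \<open>phi\<close> and of transits for different heights and different
  \<open>c\<close>\<close>

lemma quotient_monotone:
  fixes p q :: real
  assumes "0 \<le> p" "p \<le> q"
  shows "p / sqrt (1 + p\<^sup>2) \<le> q / sqrt (1 + q\<^sup>2)"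
    and "q / sqrt (1 + q\<^sup>2) \<le> p / sqrt (1 + p\<^sup>2) + (q - p)"
proof -
  note w = sqrt_facts[of p] sqrt_facts[of q]
  have "p\<^sup>2 \<le> q\<^sup>2" using assms by (intro power_mono) auto
  then have "(p * sqrt (1 + q\<^sup>2))\<^sup>2 \<le> (q * sqrt (1 + p\<^sup>2))\<^sup>2"
    unfolding power_mult_distrib w(3) w(9) distrib_left by (simp add: mult.commute)
  then have "p * sqrt (1 + q\<^sup>2) \<le> q * sqrt (1 + p\<^sup>2)"
    by (rule power2_le_imp_le) (use assms in simp)
  then show "p / sqrt (1 + p\<^sup>2) \<le> q / sqrt (1 + q\<^sup>2)"
    using frac_le_eq[of "sqrt (1 + p\<^sup>2)" "sqrt (1 + q\<^sup>2)" p q] w(1,7)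
    by (simp add: divide_nonpos_pos mult.commute)
  have "(q - p) / sqrt (1 + q\<^sup>2) \<le> (q - p) / 1"
    using w(8,10) assms by (intro divide_left_mono) simp_all
  moreover have "p / sqrt (1 + q\<^sup>2) \<le> p / sqrt (1 + p\<^sup>2)"
    by (rule divide_left_mono) (use assms w(1,7) \<open>p\<^sup>2 \<le> q\<^sup>2\<close> in \<open>simp_all del: real_sqrt_gt_0_iff\<close>)
  ultimately show "q / sqrt (1 + q\<^sup>2) \<le> p / sqrt (1 + p\<^sup>2) + (q - p)"
    unfolding diff_divide_distrib by simp
qed

text \<open>In \<open>v = p / sqrt (1 + p^2)\<close> the nonconvex term \<open>- v^3\<close> only
  decreases and drops out of an upper bound. What is left is linear in \<open>v\<close>, and
  \<open>v\<close> is 1-Lipschitz in \<open>p\<close>.\<close>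

lemma lagr_p_upper_lipschitz:
  assumes "c \<ge> 0" "s > 0" "0 \<le> p" "p \<le> q"
  shows "lagr_p c s q \<le> lagr_p c s p + (s + 2 * c / s) * (q - p)"
proof -
  define v where "v = (\<lambda>p::real. p / sqrt (1 + p\<^sup>2))"
  have v: "0 \<le> v p" "v p \<le> v q" "v q \<le> v p + (q - p)"
    using quotient_monotone[OF assms(3,4)] assms sqrt_facts(1)[of p] by (auto simp: v_def)
  have "v p ^ 3 \<le> v q ^ 3" using v by (intro power_mono) auto
  moreover have "2 * v q \<le> 2 * v p + 2 * (q - p)" using v by simp
  ultimately have "2 * v q - v q ^ 3 \<le> (2 * v p - v p ^ 3) + 2 * (q - p)" by simp
  then have "c / s * (2 * v q - v q ^ 3) \<le> c / s * ((2 * v p - v p ^ 3) + 2 * (q - p))"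
    using assms by (intro mult_left_mono) auto
  moreover have "s * v q \<le> s * (v p + (q - p))" using v assms by (intro mult_left_mono) auto
  moreover have "lagr_p c s p = s * v p + c / s * (2 * v p - v p ^ 3)"
    "lagr_p c s q = s * v q + c / s * (2 * v q - v q ^ 3)"
    using lagr_p_eq[OF assms(2)] by (simp_all add: v_def)
  moreover have "(s + 2 * c / s) * (q - p) = s * (q - p) + c / s * (2 * (q - p))"
    by (simp add: distrib_right)
  ultimately show ?thesis by (simp add: distrib_left)
qed

lemma phi_antimono:
  assumes "c \<ge> 0" "0 < a" "a \<le> b" "b \<le> s"
  shows "phi c b s \<le> phi c a s"
proof (cases "b = s")
  case True
  then show ?thesis
    using phi_a[of c s] phi_nonneg[of c a s] assms by simp
next
  case False
  then have p: "slope c a s > 0" using slope_pos[of c a s] assms by simp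
  have "phi c b s \<le> (lagr c s (slope c a s) - b) / slope c a s"
    using phi_le_quotient[of c b s] p assms by simp
  also have "\<dots> \<le> (lagr c s (slope c a s) - a) / slope c a s"
    using p assms by (intro divide_right_mono) auto
  also have "\<dots> = phi c a s"
    using lagr_slope[of c a s] assms p by simp
  finally show ?thesis .
qed

text \<open>For a fixed slope the quotient \<open>(f - a) / p\<close> is affine in \<open>a\<close>,
  so \<open>phi\<close> is concave in \<open>a\<close>, and the contact slope supplies the
  supergradient \<open>- 1 / slope\<close>. Its integral is the transit, which is how the half-width
  enters the difference quotients of \<open>val\<close>, for \<open>b\<close> on either side of
  \<open>a\<close>.\<close>

lemma phi_shift_le:
  assumes "c \<ge> 0" "0 < a" "0 < b" "a < s" "b \<le> s"
  shows "phi c b s \<le> phi c a s - (b - a) * (1 / slope c a s)"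
proof -
  have p: "slope c a s > 0" using slope_pos[of c a s] assms by simp
  have "phi c b s \<le> (lagr c s (slope c a s) - b) / slope c a s"
    using phi_le_quotient[of c b s] p assms by simp
  also have "\<dots> = phi c a s - (b - a) * (1 / slope c a s)"
    using lagr_slope[of c a s] assms p by (simp add: field_simps)
  finally show ?thesis .
qed

text \<open>Below \<open>a\<close> the supergradient bound degenerates as \<open>s\<close> tends to
  \<open>a\<close>, where the contact slope \<open>P\<close> vanishes. The test slope is therefore
  raised to \<open>P + e\<close>: lowering the height costs at most \<open>(a - b) / e\<close>,
  raising the slope at most \<open>M e\<close>, and \<open>e = sqrt (a - b)\<close> balances the
  two.\<close>

lemma phi_hoelder:
  assumes c: "c \<ge> 0" and ba: "0 < b" "b < a" "a \<le> s"
  shows "phi c b s \<le> phi c a s + (1 + s + 2 * c / s) * sqrt (a - b)"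
proof -
  define P e where "P = slope c a s" and "e = sqrt (a - b)"
  define M where "M = s + 2 * c / s"
  have s: "s > 0" "a > 0" using ba by auto
  have P: "P \<ge> 0" using slope_nonneg[of c a s] c s ba by (simp add: P_def)
  have e: "e > 0" "e * e = a - b" using ba by (auto simp: e_def)
  have M: "M \<ge> 0" using s c by (simp add: M_def)
  obtain z where z: "P < z" "z < P + e" "lagr c s (P + e) - lagr c s P = e * lagr_p c s z"
    using MVT2[of P "P + e" "lagr c s" "lagr_p c s"] lagr_has_derivative[of s c] s e by auto
  have "lagr_p c s z \<le> lagr_p c s P + M * (z - P)"
    using lagr_p_upper_lipschitz[of c s P z] z c s P by (simp add: M_def)
  also have "\<dots> \<le> lagr_p c s P + M * e"
    using z M by (intro add_left_mono mult_left_mono) auto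
  finally have "e * lagr_p c s z \<le> e * (phi c a s + M * e)"
    using e by (simp add: phi_def P_def)
  moreover have "lagr c s P = a + phi c a s * P"
    using lagr_slope[of c a s] c s ba by (simp add: P_def)
  ultimately have "lagr c s (P + e) - b \<le> (a - b) + phi c a s * (P + e) + M * (e * e)"
    using z(3) by (simp add: algebra_simps)
  then have "lagr c s (P + e) - b \<le> phi c a s * (P + e) + (1 + M) * (e * e)"
    using e(2) by (simp only: distrib_right mult_1)
  then have "(lagr c s (P + e) - b) / (P + e) \<le> (phi c a s * (P + e) + (1 + M) * (e * e)) / (P + e)"
    using P e by (intro divide_right_mono) auto
  also have "\<dots> = phi c a s + (1 + M) * (e * e) / (P + e)"
    using P e by (simp add: add_divide_distrib)
  also have "(1 + M) * (e * e) / (P + e) \<le> (1 + M) * (e * e) / e"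
    using P e(1) M by (intro divide_left_mono) simp_all
  also have "\<dots> = (1 + M) * e" using e(1) by simp
  finally have "(lagr c s (P + e) - b) / (P + e) \<le> phi c a s + (1 + M) * e" by simp
  moreover have "phi c b s \<le> (lagr c s (P + e) - b) / (P + e)"
    using phi_le_quotient[of c b s "P + e"] c ba P e by simp
  ultimately show ?thesis by (simp add: M_def e_def add.assoc)
qed

text \<open>In \<open>phi c b s + phi 0 a s\<close> the two supporting slopes \<open>p\<close> and \<open>q\<close> of the right-hand side
  serve as test slopes, exchanged if \<open>q < p\<close>; then monotonicity of
  \<open>p \<mapsto> c p / (s sqrt (1 + p\<^sup>2))\<close> decides.\<close>

lemma phi_submodular:
  assumes c: "c \<ge> 0" and ab: "0 < a" "a < b" "b \<le> s"
  shows "phi c b s + phi 0 a s \<le> phi c a s + phi 0 b s"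
proof -
  define p q where "p = slope c a s" and "q = slope 0 b s"
  have s: "s > 0" using ab by simp
  have p: "p > 0" using slope_pos[of c a s] c ab by (simp add: p_def)
  have q: "q \<ge> 0" using slope_nonneg[of 0 b s] ab by (simp add: q_def)
  have fc: "lagr c s x = lagr 0 s x + c / s * (x / sqrt (1 + x\<^sup>2)) * x" for x
    by (simp add: lagr_def power2_eq_square)
  have pc: "phi c a s = (lagr c s p - a) / p"
    using lagr_slope[of c a s] c ab p by (simp add: p_def)
  have fp: "lagr 0 s p \<le> lagr c s p"
    unfolding fc[of p] using c s p sqrt_facts(1)[of p] by simp
  show ?thesis
  proof (cases "b = s")
    case True
    have "phi 0 a s \<le> (lagr 0 s p - a) / p"
      using phi_le_quotient[of 0 a s p] ab p by simp
    also have "\<dots> \<le> phi c a s"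
      unfolding pc using fp p by (intro divide_right_mono) auto
    finally show ?thesis using True phi_a[of c s] phi_a[of 0 s] c s by simp
  next
    case False
    then have q: "q > 0" using slope_pos[of 0 b s] ab by (simp add: q_def)
    have qc: "phi 0 b s = (lagr 0 s q - b) / q"
      using lagr_slope[of 0 b s] ab q by (simp add: q_def)
    show ?thesis
    proof (cases "p \<le> q")
      case True
      have "phi c b s \<le> (lagr c s p - b) / p" "phi 0 a s \<le> (lagr 0 s q - a) / q"
        using phi_le_quotient[of c b s p] phi_le_quotient[of 0 a s q] c ab p q by simp_all
      moreover have "(b - a) / q \<le> (b - a) / p"
        using True ab p by (intro divide_left_mono) auto
      ultimately show ?thesis unfolding pc qc by (simp add: diff_divide_distrib)
    next
      case False
      have "phi c b s \<le> (lagr c s q - b) / q" "phi 0 a s \<le> (lagr 0 s p - a) / p"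
        using phi_le_quotient[of c b s q] phi_le_quotient[of 0 a s p] c ab p q by simp_all
      moreover have "(lagr c s q - b) / q = (lagr 0 s q - b) / q + c / s * (q / sqrt (1 + q\<^sup>2))"
        "(lagr c s p - a) / p = (lagr 0 s p - a) / p + c / s * (p / sqrt (1 + p\<^sup>2))"
        unfolding fc[of p] fc[of q] using p q by (simp_all add: add_divide_distrib diff_divide_distrib)
      moreover have "c / s * (q / sqrt (1 + q\<^sup>2)) \<le> c / s * (p / sqrt (1 + p\<^sup>2))"
        using quotient_monotone(1)[of q p] False q c s by (intro mult_left_mono) auto
      ultimately show ?thesis unfolding pc qc by linarith
    qed
  qed
qed

text \<open>Raising \<open>c\<close> from \<open>0\<close> and raising the minimum from
  \<open>b\<close> to \<open>a\<close> both increase the height reached at a given slope. At a given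
  height the extremal is therefore flatter than the catenary, and transit has derivative
  \<open>1 / slope\<close>.\<close>

lemma transit_less_catenary:
  assumes c: "c > 0" and a: "0 < b" "b \<le> a" and s: "a \<le> s" "s < t"
  shows "transit 0 b t - transit 0 b s < transit c a t - transit c a s"
proof -
  have slope: "slope c a x < slope 0 b x" if "a < x" for x
  proof -
    define p where "p = slope c a x"
    have p: "p > 0" using slope_pos[of c a x] that c a by (simp add: p_def)
    have q: "discr 0 b p < discr c a p"
    proof -
      have "b\<^sup>2 * (1 + p\<^sup>2) \<le> a\<^sup>2 * (1 + p\<^sup>2)"
        using a sqrt_facts(4)[of p] by (intro mult_right_mono power_mono) auto
      moreover have "4 * c * p\<^sup>2 / (1 + p\<^sup>2) > 0"
        using c p sqrt_facts(4)[of p] by (intro divide_pos_pos mult_pos_pos) auto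
      ultimately show ?thesis by (simp add: discr_def)
    qed
    have "b * sqrt (1 + p\<^sup>2) \<le> a * sqrt (1 + p\<^sup>2)"
      using a sqrt_facts(1)[of p] by (intro mult_right_mono) auto
    then have "ht 0 b p < ht c a p"
      unfolding ht_def using real_sqrt_less_mono[OF q]
      by (intro divide_strict_right_mono add_le_less_mono) simp_all
    also have "\<dots> = x" using ht_slope[of c a x] c a that by (simp add: p_def)
    also have "x = ht 0 b (slope 0 b x)" using ht_slope[of 0 b x] a that by simp
    finally have "ht 0 b p < ht 0 b (slope 0 b x)" .
    then show ?thesis
      using ht_less_iff[of 0 b p "slope 0 b x"] slope_nonneg[of 0 b x] p a that by (simp add: p_def)
  qed
  have "transit c a s - transit 0 b s < transit c a t - transit 0 b t"
  proof (rule DERIV_pos_imp_increasing_open[OF s(2)])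
    fix x assume x: "s < x" "x < t"
    have "((\<lambda>x. transit c a x - transit 0 b x) has_real_derivative 1 / slope c a x - 1 / slope 0 b x) (at x)"
      using x s a c by (intro DERIV_diff transit_has_derivative) auto
    moreover have "1 / slope 0 b x < 1 / slope c a x"
      using slope[of x] slope_pos[of c a x] x s a c by (intro divide_strict_left_mono mult_pos_pos) auto
    ultimately show "\<exists>y. ((\<lambda>x. transit c a x - transit 0 b x) has_real_derivative y) (at x) \<and> y > 0"
      by (intro exI[of _ "1 / slope c a x - 1 / slope 0 b x"]) simp
  next
    show "continuous_on {s..t} (\<lambda>x. transit c a x - transit 0 b x)"
      using c a s
      by (intro continuous_on_diff continuous_on_subset[OF continuous_on_transit]) auto
  qed
  then show ?thesis by simp
qed

section \<open>The value function\<close>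

lemma val_le_shift:
  assumes "c \<ge> 0" "0 < a" "a \<le> b" "b \<le> r"
  shows "val h r c b \<le> val h r c a + 2 * h * (b - a)"
proof -
  have "integral {b..r} (phi c b) \<le> integral {b..r} (phi c a)"
    using assms phi_integrable[of c b b r] phi_integrable[of c a b r] phi_antimono[of c a b]
    by (intro integral_le) auto
  also have "\<dots> \<le> integral {a..r} (phi c a)"
    using phi_integral_split[of c a a b r] phi_integral_nonneg[of c a a b] assms by simp
  finally show ?thesis by (simp add: val_def algebra_simps)
qed

text \<open>On the new piece \<open>[b, a]\<close> the bound is \<open>phi_near_le\<close> with
  \<open>d = a - b\<close>, on \<open>[a, r]\<close> it is \<open>phi_hoelder\<close>. The constant
  is uniform for heights \<open>\<ge> p\<close> but contains \<open>c / p\<close>, so continuity of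
  \<open>val\<close> is obtained away from height \<open>0\<close>.\<close>

lemma val_hoelder:
  assumes c: "c \<ge> 0" and p: "0 < p" "p \<le> b" "b < a" "a \<le> r" and h: "h \<ge> 0"
  shows "val h r c b \<le> val h r c a + 2 * ((1 + r + 2 * c / p) * r) * sqrt (a - b)"
proof -
  define M where "M = 1 + r + 2 * c / p"
  define e where "e = sqrt (a - b)"
  have e: "e > 0" "e * e = a - b" using p by (auto simp: e_def)
  have M: "1 + s + 2 * c / s \<le> M" if "p \<le> s" "s \<le> r" for s
  proof -
    have "2 * c / s \<le> 2 * c / p" using that c p by (intro divide_left_mono) auto
    then show ?thesis using that by (simp add: M_def)
  qed
  have 1: "integral {b..a} (phi c b) \<le> M * e * (a - b)"
  proof (rule integral_le_const)
    fix s assume s: "b \<le> s" "s \<le> a"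
    have "phi c b s \<le> (s - b + (s + c / s) * (a - b)) / sqrt (a - b)"
      using phi_near_le[of c b s "a - b"] c p s by simp
    also have "\<dots> \<le> (M * (a - b)) / sqrt (a - b)"
    proof (rule divide_right_mono)
      have "c / s \<le> 2 * c / s" using c p s by (simp add: divide_right_mono)
      then have "1 + (s + c / s) \<le> M" using M[of s] s p by simp
      then have "(1 + (s + c / s)) * (a - b) \<le> M * (a - b)" using p by (intro mult_right_mono) auto
      then show "s - b + (s + c / s) * (a - b) \<le> M * (a - b)" using s by (simp add: distrib_right)
    qed (use p in simp)
    also have "\<dots> = M * e" using e by (simp add: e_def[symmetric] flip: e(2))
    finally show "phi c b s \<le> M * e" .
  qed (use c p phi_integrable[of c b b a] in auto)
  have "integral {a..r} (phi c b) \<le> integral {a..r} (\<lambda>s. phi c a s + M * e)"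
  proof (rule integral_le)
    fix s assume s: "s \<in> {a..r}"
    have "phi c b s \<le> phi c a s + (1 + s + 2 * c / s) * e"
      using phi_hoelder[of c b a s] c p s by (simp add: e_def)
    moreover have "(1 + s + 2 * c / s) * e \<le> M * e"
      using M[of s] p s e by (intro mult_right_mono) auto
    ultimately show "phi c b s \<le> phi c a s + M * e" by simp
  qed (use c p phi_integrable[of c b a r] phi_integrable[of c a a r] in \<open>auto intro!: integrable_add\<close>)
  also have "\<dots> = integral {a..r} (phi c a) + M * e * (r - a)"
    using phi_integrable[of c a a r] c p by (subst integral_add) (auto simp: mult.commute)
  finally have "integral {b..r} (phi c b) \<le> integral {a..r} (phi c a) + M * e * (r - b)"
    using 1 phi_integral_split[of c b b a r] c p by (simp add: algebra_simps)
  moreover have "M * e * (r - b) \<le> M * e * r"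
    using M[of r] p c e by (intro mult_left_mono mult_nonneg_nonneg)
      (auto simp: M_def intro!: add_nonneg_nonneg)
  moreover have "h * b \<le> h * a" using h p by (intro mult_left_mono) auto
  ultimately have "val h r c b \<le> val h r c a + 2 * (M * e * r)"
    by (simp add: val_def)
  then show ?thesis unfolding M_def e_def by (simp only: mult_ac)
qed

lemma continuous_on_val:
  assumes c: "c \<ge> 0" and p: "0 < p" and h: "h \<ge> 0"
  shows "continuous_on {p..r} (val h r c)"
proof -
  define K where "K = 2 * ((1 + r + 2 * c / p) * r)"
  have ord: "\<bar>val h r c b - val h r c a\<bar> \<le> 2 * h * \<bar>b - a\<bar> + K * sqrt \<bar>b - a\<bar>"
    if "p \<le> b" "b \<le> a" "a \<le> r" for a b
  proof -
    have K: "K \<ge> 0" using that c p by (simp add: K_def)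
    have "val h r c b \<le> val h r c a + K * sqrt (a - b)"
      using val_hoelder[of c p b a r h] that c p h by (cases "a = b") (auto simp: K_def)
    moreover have "val h r c a \<le> val h r c b + 2 * h * (a - b)"
      using val_le_shift[of c b a r h] that c p by simp
    moreover have "0 \<le> 2 * h * (a - b)" "0 \<le> K * sqrt (a - b)" using that h K by simp_all
    ultimately show ?thesis using that by (simp add: abs_le_iff abs_minus_commute)
  qed
  have "(val h r c \<longlongrightarrow> val h r c x) (at x within {p..r})" if x: "x \<in> {p..r}" for x
  proof (rule LIM_zero_cancel, rule Lim_null_comparison)
    show "\<forall>\<^sub>F y in at x within {p..r}.
        norm (val h r c y - val h r c x) \<le> 2 * h * \<bar>y - x\<bar> + K * sqrt \<bar>y - x\<bar>"
      unfolding eventually_at_filter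
    proof (intro always_eventually allI impI)
      fix y assume "y \<in> {p..r}"
      then show "norm (val h r c y - val h r c x) \<le> 2 * h * \<bar>y - x\<bar> + K * sqrt \<bar>y - x\<bar>"
        using ord[of y x] ord[of x y] x by (cases "y \<le> x") (auto simp: abs_minus_commute)
    qed
    have "((\<lambda>y. 2 * h * \<bar>y - x\<bar> + K * sqrt \<bar>y - x\<bar>) \<longlongrightarrow> 2 * h * \<bar>x - x\<bar> + K * sqrt \<bar>x - x\<bar>)
        (at x within {p..r})"
      by (intro tendsto_intros)
    then show "((\<lambda>y. 2 * h * \<bar>y - x\<bar> + K * sqrt \<bar>y - x\<bar>) \<longlongrightarrow> 0) (at x within {p..r})" by simp
  qed
  then show ?thesis by (simp add: continuous_on_def)
qed

lemma val_submodular: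
  assumes c: "c \<ge> 0" and ab: "0 < a" "a < b" "b \<le> r"
  shows "val h r c b + val h r 0 a \<le> val h r c a + val h r 0 b"
proof -
  have "integral {a..b} (phi 0 a) \<le> integral {a..b} (phi c a)"
  proof (rule integral_le)
    fix s assume s: "s \<in> {a..b}"
    show "phi 0 a s \<le> phi c a s"
    proof (cases "s = a")
      case True
      then show ?thesis using c ab by simp
    next
      case False
      \<comment> \<open>With the upper height equal to \<open>s\<close>, the terms
        \<open>phi c s s\<close> and \<open>phi 0 s s\<close> vanish and submodularity becomes
        monotonicity in \<open>c\<close>.\<close>
      then show ?thesis using phi_submodular[of c a s s] c ab s by simp
    qed
  qed (use c ab phi_integrable in auto)
  moreover have "integral {b..r} (\<lambda>s. phi c b s + phi 0 a s) \<le> integral {b..r} (\<lambda>s. phi c a s + phi 0 b s)"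
    using c ab by (intro integral_le integrable_add phi_integrable phi_submodular) auto
  then have "integral {b..r} (phi c b) + integral {b..r} (phi 0 a)
      \<le> integral {b..r} (phi c a) + integral {b..r} (phi 0 b)"
    using c ab by (simp add: Henstock_Kurzweil_Integration.integral_add phi_integrable)
  ultimately show ?thesis
    using phi_integral_split[of c a a b r] phi_integral_split[of 0 a a b r] c ab by (simp add: val_def)
qed

section \<open>First-order condition at a minimum of \<open>val\<close>\<close>

text \<open>Comparison with the slightly lower height \<open>b = a - d\<close>. Above
  \<open>m\<close> the supergradient bound costs at most \<open>d\<close> times the transit, the
  piece \<open>[b, m]\<close> costs \<open>o(d)\<close>, and lowering the height gains
  \<open>d h\<close>; divide by \<open>d\<close>.\<close>

lemma transit_ge_of_val_minimal:
  assumes c: "c \<ge> 0" and a: "0 < a" "a \<le> r" and h: "h > 0"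
    and min: "\<And>b. 0 < b \<Longrightarrow> b \<le> r \<Longrightarrow> val h r c a \<le> val h r c b"
  shows "h \<le> transit c a r"
proof (rule field_le_epsilon)
  fix \<epsilon> :: real assume \<epsilon>: "\<epsilon> > 0"
  define M where "M = r + 2 * c / a"
  have M: "M > 0" using c a by (simp add: M_def add_pos_nonneg)
  \<comment> \<open>Chosen so that the final error \<open>2 * (2 + M) * sqrt d\<close> is at most
    \<open>\<epsilon>\<close>.\<close>
  define e where "e = \<epsilon> / (2 * (2 + M))"
  have e: "e > 0" using \<epsilon> M by (simp add: e_def)
  \<comment> \<open>The bound \<open>a / 2\<close> keeps \<open>b \<ge> a / 2\<close>, so that
    \<open>M\<close> dominates \<open>s + c / s\<close> on \<open>[b, m]\<close>.\<close>
  define d where "d = min (a / 2) (e\<^sup>2)"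
  have d: "d > 0" "d \<le> a / 2" "sqrt d \<le> e"
    using a e real_sqrt_le_mono[of d "e\<^sup>2"] by (auto simp: d_def)
  \<comment> \<open>The cut \<open>m\<close> stays a distance \<open>d\<close> above
    \<open>a\<close>, away from the singularity of \<open>1 / slope\<close>; the minimum with
    \<open>r\<close> also covers heights \<open>a\<close> close to \<open>r\<close> and
    \<open>a = r\<close> itself.\<close>
  define b m where "b = a - d" and "m = min (a + d) r"
  have bm: "0 < b" "a / 2 \<le> b" "b < a" "a \<le> m" "m \<le> r" "m - b \<le> 2 * d"
    using d a by (auto simp: b_def m_def)
  have "integral {b..m} (phi c b) \<le> (2 + M) * sqrt d * (m - b)"
  proof (rule integral_le_const)
    fix s assume s: "b \<le> s" "s \<le> m"
    have "c / s \<le> c / (a / 2)" using s bm c a by (intro divide_left_mono) auto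
    then have sM: "s + c / s \<le> M" using s bm by (simp add: M_def mult.commute)
    have "phi c b s \<le> (s - b + (s + c / s) * d) / sqrt d"
      using phi_near_le[of c b s d] c bm s d by simp
    also have "\<dots> \<le> ((2 + M) * d) / sqrt d"
    proof (rule divide_right_mono)
      have "(s + c / s) * d \<le> M * d" using sM d by (intro mult_right_mono) auto
      then show "s - b + (s + c / s) * d \<le> (2 + M) * d"
        using s bm by (simp add: distrib_right)
    qed (use d in simp)
    also have "\<dots> = (2 + M) * sqrt d" using d real_div_sqrt[of d] by (metis less_imp_le times_divide_eq_right)
    finally show "phi c b s \<le> (2 + M) * sqrt d" .
  qed (use c bm phi_integrable in auto)
  also have "\<dots> \<le> (2 + M) * sqrt d * (2 * d)" using bm M d by (intro mult_left_mono) auto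
  finally have 1: "integral {b..m} (phi c b) \<le> (2 + M) * sqrt d * (2 * d)" .
  have 2: "integral {m..r} (phi c b) \<le> integral {m..r} (phi c a) + d * transit c a r"
  proof (cases "m = r")
    case True
    then show ?thesis using d transit_nonneg[of c a r] c a by simp
  next
    case False
    then have m: "a < m" using d bm by (auto simp: m_def)
    note T = transit_integral[OF c a(1) m bm(5)]
    have "integral {m..r} (phi c b) \<le> integral {m..r} (\<lambda>s. phi c a s + d * (1 / slope c a s))"
    proof (rule integral_le)
      show "(\<lambda>s. phi c a s + d * (1 / slope c a s)) integrable_on {m..r}"
        using T c a m by (intro integrable_add phi_integrable integrable_on_mult_right) auto
      fix s assume "s \<in> {m..r}"
      then show "phi c b s \<le> phi c a s + d * (1 / slope c a s)"
        using phi_shift_le[of c a b s] c a bm m by (simp add: b_def)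
    qed (use c bm phi_integrable in auto)
    also have "\<dots> = integral {m..r} (phi c a) + integral {m..r} (\<lambda>s. d * (1 / slope c a s))"
      using T c a m by (intro integral_add phi_integrable integrable_on_mult_right) auto
    also have "\<dots> = integral {m..r} (phi c a) + d * (transit c a r - transit c a m)"
      using integral_unique[OF has_integral_mult_right[OF T, of d]] by simp
    also have "\<dots> \<le> integral {m..r} (phi c a) + d * transit c a r"
      using d transit_nonneg[of c a m] c a m by (intro add_left_mono mult_left_mono) auto
    finally show ?thesis .
  qed
  have "integral {b..r} (phi c b) = integral {b..m} (phi c b) + integral {m..r} (phi c b)"
    using phi_integral_split[of c b b m r] c bm by simp
  moreover have "integral {m..r} (phi c a) \<le> integral {a..r} (phi c a)"
    using phi_integral_split[of c a a m r] phi_integral_nonneg[of c a a m] c a bm by simp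
  ultimately have "integral {b..r} (phi c b)
      \<le> (2 + M) * sqrt d * (2 * d) + integral {a..r} (phi c a) + d * transit c a r"
    using 1 2 by linarith
  moreover have "val h r c a \<le> val h r c b" using min[of b] bm by simp
  ultimately have "h * a \<le> h * b + (2 + M) * sqrt d * (2 * d) + d * transit c a r"
    by (simp add: val_def)
  then have "d * h \<le> d * (2 * (2 + M) * sqrt d + transit c a r)"
    by (simp add: b_def algebra_simps)
  then have "h \<le> 2 * (2 + M) * sqrt d + transit c a r" using d by simp
  also have "2 * (2 + M) * sqrt d \<le> 2 * (2 + M) * e"
    using d M by (intro mult_left_mono) auto
  also have "\<dots> = \<epsilon>" using M by (simp add: e_def)
  finally show "h \<le> transit c a r + \<epsilon>" by simp
qed

text \<open>For a higher competitor \<open>b > a\<close> the integral of \<open>phi c b\<close>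
  begins at \<open>b\<close>, beyond the singularity at \<open>a\<close>. The comparison is
  therefore exact for every \<open>b\<close>, without an error term, and \<open>b\<close> then tends
  to \<open>a\<close>.\<close>

lemma transit_le_of_val_minimal:
  assumes c: "c \<ge> 0" and a: "0 < a" "a < r" and h: "h > 0"
    and min: "\<And>b. 0 < b \<Longrightarrow> b \<le> r \<Longrightarrow> val h r c a \<le> val h r c b"
  shows "transit c a r \<le> h"
proof -
  have le: "transit c a r - transit c a b \<le> h" if b: "a < b" "b < r" for b
  proof -
    note T = transit_integral[OF c a(1) b(1) less_imp_le[OF b(2)]]
    have "integral {b..r} (phi c b) \<le> integral {b..r} (\<lambda>s. phi c a s - (b - a) * (1 / slope c a s))"
    proof (rule integral_le)
      show "(\<lambda>s. phi c a s - (b - a) * (1 / slope c a s)) integrable_on {b..r}"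
        using T c a b by (intro integrable_diff phi_integrable integrable_on_mult_right) auto
      fix s assume "s \<in> {b..r}"
      then show "phi c b s \<le> phi c a s - (b - a) * (1 / slope c a s)"
        using phi_shift_le[of c a b s] c a b by simp
    qed (use c a b phi_integrable in auto)
    also have "\<dots> = integral {b..r} (phi c a) - integral {b..r} (\<lambda>s. (b - a) * (1 / slope c a s))"
      using T c a b by (intro integral_diff phi_integrable integrable_on_mult_right) auto
    also have "\<dots> = integral {b..r} (phi c a) - (b - a) * (transit c a r - transit c a b)"
      using integral_unique[OF has_integral_mult_right[OF T, of "b - a"]] by simp
    also have "integral {b..r} (phi c a) \<le> integral {a..r} (phi c a)"
      using phi_integral_split[of c a a b r] phi_integral_nonneg[of c a a b] c a b by simp
    finally have "integral {b..r} (phi c b)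
        \<le> integral {a..r} (phi c a) - (b - a) * (transit c a r - transit c a b)" by simp
    moreover have "val h r c a \<le> val h r c b" using min[of b] a b by simp
    ultimately have "(b - a) * (transit c a r - transit c a b) \<le> (b - a) * h"
      by (simp add: val_def algebra_simps)
    then show ?thesis using b by simp
  qed
  have "continuous_on {a..} (transit c a)" using continuous_on_transit[of c a] c a by simp
  then have "(transit c a \<longlongrightarrow> transit c a a) (at a within {a..})"
    by (simp add: continuous_on_def)
  then have "(transit c a \<longlongrightarrow> 0) (at_right a)"
    using transit_a[OF c a(1)] tendsto_within_subset[of "transit c a" "nhds 0" a "{a..}" "{a<..}"]
    by (simp add: greaterThan_def atLeast_def subset_eq)
  then have lim: "((\<lambda>b. transit c a r - transit c a b) \<longlongrightarrow> transit c a r - 0) (at_right a)"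
    by (intro tendsto_intros)
  have "\<forall>\<^sub>F b in at_right a. transit c a r - transit c a b \<le> h"
    using le a unfolding eventually_at_right_field by (intro exI[of _ r]) simp
  then show ?thesis
    using tendsto_upperbound[OF lim] by simp
qed

lemma transit_eq_of_val_minimal:
  assumes c: "c \<ge> 0" and a: "0 < a" "a \<le> r" and h: "h > 0"
    and min: "\<And>b. 0 < b \<Longrightarrow> b \<le> r \<Longrightarrow> val h r c a \<le> val h r c b"
  shows "transit c a r = h" and "a < r"
proof -
  have ge: "h \<le> transit c a r" by (rule transit_ge_of_val_minimal[OF assms])
  \<comment> \<open>The cylinder is excluded: \<open>transit c r r = 0 < h\<close>.\<close>
  then show "a < r" using h a c by (cases "a = r") auto
  then show "transit c a r = h"
    using ge transit_le_of_val_minimal[OF c a(1) _ h min] by simp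
qed

section \<open>The catenary\<close>

lemma discr_zero: "0 < b \<Longrightarrow> sqrt (discr 0 b p) = b * sqrt (1 + p\<^sup>2)"
  by (simp add: discr_def real_sqrt_mult)

lemma ht_catenary: "0 < b \<Longrightarrow> ht 0 b p = b * sqrt (1 + p\<^sup>2)"
  by (simp add: ht_def discr_zero)

lemma sqrt_one_plus_sinh: "sqrt (1 + (sinh t)\<^sup>2) = cosh (t::real)"
  using cosh_square_eq[of t] by (intro real_sqrt_unique) simp_all

lemma slope_catenary: "0 < b \<Longrightarrow> 0 \<le> t \<Longrightarrow> slope 0 b (b * cosh t) = sinh t"
  using slope_ht[of 0 b "sinh t"] by (simp add: ht_catenary sqrt_one_plus_sinh)

lemma speed_catenary:
  assumes "0 < b"
  shows "speed 0 b p = b / sqrt (1 + p\<^sup>2)"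
proof -
  have "b\<^sup>2 / (b * sqrt (1 + p\<^sup>2)) = b / sqrt (1 + p\<^sup>2)"
    using assms by (simp add: power2_eq_square)
  then show ?thesis unfolding speed_def discr_zero[OF assms] by simp
qed

lemma pos_catenary:
  assumes b: "0 < b"
  shows "pos 0 b (sinh t) = b * t"
proof -
  have "((\<lambda>t. pos 0 b (sinh t) - b * t) has_real_derivative 0) (at x)" for x
  proof -
    have 1: "((\<lambda>t. pos 0 b (sinh t)) has_real_derivative speed 0 b (sinh x) * cosh x) (at x)"
      by (rule DERIV_chain2[OF pos_has_derivative])
         (use b in \<open>auto intro!: derivative_eq_intros\<close>)
    have 2: "((\<lambda>t. b * t) has_real_derivative b) (at x)"
      by (auto intro!: derivative_eq_intros)
    have "speed 0 b (sinh x) * cosh x - b = 0"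
      by (simp add: speed_catenary[OF b] sqrt_one_plus_sinh)
    then show ?thesis using DERIV_diff[OF 1 2] by simp
  qed
  then have "pos 0 b (sinh t) - b * t = pos 0 b (sinh 0) - b * 0"
    using DERIV_isconst_all[of "\<lambda>t. pos 0 b (sinh t) - b * t" t 0] by blast
  then show ?thesis using b by simp
qed

lemma transit_catenary: "0 < b \<Longrightarrow> 0 \<le> t \<Longrightarrow> transit 0 b (b * cosh t) = b * t"
  by (simp add: transit_def slope_catenary pos_catenary)

lemma phi_catenary:
  assumes "0 < b" "b \<le> s"
  shows "phi 0 b s = b * slope 0 b s"
proof -
  have "s = b * sqrt (1 + (slope 0 b s)\<^sup>2)"
    using ht_slope[of 0 b s] ht_catenary[of b "slope 0 b s"] assms by simp
  moreover have "b * sqrt (1 + (slope 0 b s)\<^sup>2) * slope 0 b s / sqrt (1 + (slope 0 b s)\<^sup>2) = b * slope 0 b s"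
    using sqrt_facts(4)[of "slope 0 b s"] by simp
  ultimately have "s * slope 0 b s / sqrt (1 + (slope 0 b s)\<^sup>2) = b * slope 0 b s" by metis
  then show ?thesis by (simp add: phi_def lagr_p_def)
qed

text \<open>In terms of \<open>s\<close>, \<open>phi 0 b s = sqrt (s^2 - b^2)\<close> and
  \<open>transit 0 b s = b arcosh (s / b)\<close>, so \<open>G\<close> is the familiar primitive
  \<open>(s sqrt (s^2 - b^2) - b^2 arcosh (s / b)) / 2\<close>. Its ingredients are differentiable
  only for \<open>s > b\<close>, hence the fundamental theorem on the interior.\<close>

lemma phi_catenary_integral:
  assumes b: "0 < b" "b \<le> r"
  shows "integral {b..r} (phi 0 b) = (r * phi 0 b r - b * transit 0 b r) / 2"
proof (cases "b = r")
  case True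
  then show ?thesis using b by simp
next
  case False
  define G where "G = (\<lambda>s. (s * phi 0 b s - b * transit 0 b s) / 2)"
  have "(phi 0 b has_integral G r - G b) {b..r}"
  proof (rule fundamental_theorem_of_calculus_interior[OF b(2)])
    show "continuous_on {b..r} G"
      unfolding G_def
      by (intro continuous_intros continuous_on_subset[OF continuous_on_phi[of 0 b]]
          continuous_on_subset[OF continuous_on_transit[of 0 b]]) (use b in auto)
    fix s assume s: "s \<in> {b<..<r}"
    define P where "P = slope 0 b s"
    have P: "P > 0" using slope_pos[of 0 b s] b s by (simp add: P_def)
    have sP: "s = b * sqrt (1 + P\<^sup>2)"
      using ht_slope[of 0 b s] ht_catenary[of b P] b s by (simp add: P_def)
    have s2: "s * s = b * b * (1 + P * P)"
      using sP sqrt_facts(3)[of P] by (simp add: power2_eq_square mult_ac)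
    have "P * speed 0 b P = P * b * b / s"
      unfolding speed_catenary[OF b(1)] sP using b by simp
    then have 1: "(slope 0 b has_real_derivative s / (P * b * b)) (at s)"
      using slope_has_derivative[of 0 b s] b s by (simp add: P_def)
    have 2: "((\<lambda>s. s * (b * slope 0 b s) - b * transit 0 b s) has_real_derivative
        (1 * (b * P) + (b * (s / (P * b * b))) * s) - b * (1 / P)) (at s)"
      using transit_has_derivative[of 0 b s] 1 b s unfolding P_def
      by (intro DERIV_diff DERIV_mult DERIV_cmult DERIV_ident) auto
    have "(1 * (b * P) + (b * (s / (P * b * b))) * s) - b * (1 / P) = b * P + (s * s / (b * P) - b / P)"
      using b P by (simp add: mult_ac)
    also have "s * s / (b * P) - b / P = b * P"
      unfolding s2 using b P by (simp add: field_simps)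
    finally have "(1 * (b * P) + (b * (s / (P * b * b))) * s) - b * (1 / P) = b * P + b * P" .
    then have "((\<lambda>s. (s * (b * slope 0 b s) - b * transit 0 b s) / 2) has_real_derivative b * P) (at s)"
      by (intro DERIV_cong[OF DERIV_cdivide[OF 2, of 2]], elim ssubst) simp
    then have "(G has_real_derivative b * P) (at s)"
      by (rule has_field_derivative_transform_within_open[where S = "{b<..}"])
         (use b s phi_catenary in \<open>auto simp: G_def\<close>)
    then show "(G has_vector_derivative phi 0 b s) (at s)"
      using phi_catenary[of b s] b s
      by (simp add: P_def has_real_derivative_iff_has_vector_derivative)
  qed
  moreover have "G b = 0" using b by (simp add: G_def)
  ultimately have "(phi 0 b has_integral G r) {b..r}" by simp
  then have "integral {b..r} (phi 0 b) = G r" by (rule integral_unique)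
  then show ?thesis by (simp add: G_def)
qed

lemma val_catenary:
  fixes r :: real
  assumes "r > 0" "t \<ge> 0"
  shows "val h r 0 (r / cosh t) = 2 * h * r / cosh t + r\<^sup>2 * (tanh t - t / (cosh t)\<^sup>2)"
proof -
  define b where "b = r / cosh t"
  have ch: "cosh t > 0" "cosh t \<ge> 1" by (simp_all add: cosh_real_ge_1)
  have b: "b > 0" "r = b * cosh t" "b \<le> r"
    using assms ch by (auto simp: b_def divide_le_eq mult_le_cancel_left1)
  have "integral {b..r} (phi 0 b) = (r * (b * sinh t) - b * (b * t)) / 2"
    using phi_catenary_integral[OF b(1,3)] phi_catenary[OF b(1,3)] slope_catenary[OF b(1) assms(2)]
      transit_catenary[OF b(1) assms(2)] b(2) by simp
  then have "val h r 0 b = 2 * h * b + (r * (b * sinh t) - b * (b * t))"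
    by (simp add: val_def)
  also have "r * (b * sinh t) - b * (b * t) = r\<^sup>2 * (tanh t - t / (cosh t)\<^sup>2)"
    using ch by (simp add: b_def tanh_def power2_eq_square right_diff_distrib)
  finally show ?thesis by (simp add: b_def)
qed

section \<open>The threshold \<open>omega\<close> and the largest catenary\<close>

text \<open>The left side is the energy of a catenary with \<open>h / r = t / cosh t\<close>,
  divided by \<open>r^2\<close>, and equality is the equation for \<open>Xi\<close> at
  \<open>t = 1 / Xi\<close>. Multiplying by \<open>(cosh t)^2\<close> and using
  \<open>cosh t (cosh t - sinh t) = (1 + exp (- 2 t)) / 2\<close> gives an equation whose difference
  of sides is strictly monotone.\<close>

lemma one_le_tanh_plus_iff:
  fixes t :: real
  shows "tanh t + t / (cosh t)\<^sup>2 \<le> 1 \<longleftrightarrow> 2 * t \<le> 1 + exp (- 2 * t)"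
    and "tanh t + t / (cosh t)\<^sup>2 = 1 \<longleftrightarrow> 2 * t = 1 + exp (- 2 * t)"
proof -
  have ch: "cosh t > 0" by simp
  have "cosh t * (cosh t - sinh t) = (exp t + exp (- t)) * exp (- t) / 2"
    by (simp add: cosh_def sinh_def field_simps)
  also have "(exp t + exp (- t)) * exp (- t) = 1 + exp (- 2 * t)"
    by (simp add: distrib_right flip: exp_add)
  finally have e: "cosh t * (cosh t - sinh t) = (1 + exp (- 2 * t)) / 2" .
  have q: "tanh t + t / (cosh t)\<^sup>2 - 1 = (t - cosh t * (cosh t - sinh t)) / (cosh t)\<^sup>2"
    using ch by (simp add: tanh_def field_simps power2_eq_square)
  have "tanh t + t / (cosh t)\<^sup>2 - 1 \<le> 0 \<longleftrightarrow> 2 * t - (1 + exp (- 2 * t)) \<le> 0"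
    unfolding q e using ch by (simp add: divide_le_0_iff field_simps)
  then show "tanh t + t / (cosh t)\<^sup>2 \<le> 1 \<longleftrightarrow> 2 * t \<le> 1 + exp (- 2 * t)"
    by (simp only: diff_le_0_iff_le)
  have "tanh t + t / (cosh t)\<^sup>2 - 1 = 0 \<longleftrightarrow> 2 * t - (1 + exp (- 2 * t)) = 0"
    unfolding q e using ch by (simp add: field_simps)
  then show "tanh t + t / (cosh t)\<^sup>2 = 1 \<longleftrightarrow> 2 * t = 1 + exp (- 2 * t)"
    by (simp only: right_minus_eq)
qed

text \<open>The function is the numerator of the derivative of \<open>t / cosh t\<close>. Being
  nonincreasing, it passes at most once from positive to negative, which makes
  \<open>t / cosh t\<close> unimodal.\<close>

lemma cosh_minus_antimono:
  fixes s t :: real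
  assumes "0 \<le> s" "s \<le> t"
  shows "cosh t - t * sinh t \<le> cosh s - s * sinh s"
proof (rule DERIV_nonpos_imp_nonincreasing[OF assms(2)])
  fix x assume x: "s \<le> x" "x \<le> t"
  have "((\<lambda>t. cosh t - t * sinh t) has_real_derivative - (x * cosh x)) (at x)"
    by (auto intro!: derivative_eq_intros)
  then show "\<exists>y. ((\<lambda>t. cosh t - t * sinh t) has_real_derivative y) (at x) \<and> y \<le> 0"
    using x assms by (intro exI[of _ "- (x * cosh x)"]) simp
qed

lemma div_cosh_has_derivative:
  "((\<lambda>t::real. t / cosh t) has_real_derivative (cosh x - x * sinh x) / (cosh x)\<^sup>2) (at x)"
  by (auto intro!: derivative_eq_intros simp: power2_eq_square)

lemma div_cosh_unimodal:
  fixes u :: real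
  assumes "0 \<le> u" "u \<le> x" "x \<le> t" "k \<le> u / cosh u" "k \<le> t / cosh t"
  shows "k \<le> x / cosh x"
proof (cases "cosh x - x * sinh x \<ge> 0")
  case True
  have "u / cosh u \<le> x / cosh x"
  proof (rule DERIV_nonneg_imp_nondecreasing[OF assms(2)])
    fix y assume "u \<le> y" "y \<le> x"
    then show "\<exists>d. ((\<lambda>t. t / cosh t) has_real_derivative d) (at y) \<and> 0 \<le> d"
      using cosh_minus_antimono[of y x] True assms
      by (intro exI[of _ "(cosh y - y * sinh y) / (cosh y)\<^sup>2"] conjI div_cosh_has_derivative) simp
  qed
  then show ?thesis using assms by simp
next
  case False
  have "t / cosh t \<le> x / cosh x"
  proof (rule DERIV_nonpos_imp_nonincreasing[OF assms(3)])
    fix y assume "x \<le> y" "y \<le> t"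
    then show "\<exists>d. ((\<lambda>t. t / cosh t) has_real_derivative d) (at y) \<and> d \<le> 0"
      using cosh_minus_antimono[of x y] False assms
      by (intro exI[of _ "(cosh y - y * sinh y) / (cosh y)\<^sup>2"] conjI div_cosh_has_derivative)
         (simp add: divide_nonpos_nonneg)
  qed
  then show ?thesis using assms by simp
qed

text \<open>The maximum of \<open>t / cosh t\<close> lies at \<open>t tanh t = 1\<close>, beyond
  \<open>1\<close>; the root that defines \<open>omega\<close> lies below \<open>1\<close>, on the
  increasing branch.\<close>

lemma div_cosh_strict_mono:
  fixes u :: real
  assumes "0 \<le> u" "u < t" "t \<le> 1"
  shows "u / cosh u < t / cosh t"
proof (rule DERIV_pos_imp_increasing[OF assms(2)])
  fix y assume y: "u \<le> y" "y \<le> t"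
  have "y * sinh y \<le> 1 * sinh y" using y assms by (intro mult_right_mono) auto
  also have "\<dots> < cosh y" using sinh_less_cosh_real[of y] by simp
  finally have "(cosh y - y * sinh y) / (cosh y)\<^sup>2 > 0" by simp
  then show "\<exists>d. ((\<lambda>t. t / cosh t) has_real_derivative d) (at y) \<and> 0 < d"
    using div_cosh_has_derivative[of y] by blast
qed

text \<open>With \<open>a = r / cosh t\<close>, the derivative of \<^term>\<open>val h r 0 a\<close> in \<open>t\<close> has the sign of
  \<open>t / cosh t - h / r\<close>. So on \<open>t \<ge> \<tau>\<close> the value first increases and then decreases towards
  \<open>r\<^sup>2\<close>, the value of the Goldschmidt configuration.\<close>

lemma val_catenary_minimal:
  fixes r \<tau> t :: real
  assumes r: "r > 0" and \<tau>: "0 < \<tau>" "2 * \<tau> \<le> 1 + exp (- 2 * \<tau>)" "\<tau> \<le> t"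
    and h: "h = r * (\<tau> / cosh \<tau>)"
  shows "val h r 0 (r / cosh \<tau>) \<le> val h r 0 (r / cosh t)"
proof -
  define W where "W = (\<lambda>t. 2 * h * r / cosh t + r\<^sup>2 * (tanh t - t / (cosh t)\<^sup>2))"
  have W: "val h r 0 (r / cosh x) = W x" if "x \<ge> 0" for x
    using val_catenary[OF r that] by (simp add: W_def)
  have "W \<tau> \<le> W t"
  proof (cases "\<tau> / cosh \<tau> \<le> t / cosh t")
    case True
    show ?thesis
    proof (rule DERIV_nonneg_imp_nondecreasing[OF \<tau>(3)])
      fix x assume x: "\<tau> \<le> x" "x \<le> t"
      have ge: "\<tau> / cosh \<tau> \<le> x / cosh x"
        using div_cosh_unimodal[OF _ x _ True] \<tau> by simp
      have ch: "cosh x \<noteq> 0" using cosh_real_pos[of x] by linarith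
      have d1: "((\<lambda>t. 2 * h * r / cosh t) has_real_derivative - (2 * h * r * sinh x / (cosh x)\<^sup>2)) (at x)"
        using ch by (auto intro!: derivative_eq_intros simp: power2_eq_square)
      have d2: "(tanh has_real_derivative 1 - (tanh x)\<^sup>2) (at x)"
        using ch by (auto intro!: derivative_eq_intros)
      have d3: "((\<lambda>t. t / (cosh t)\<^sup>2) has_real_derivative 1 / (cosh x)\<^sup>2 - 2 * x * sinh x / (cosh x)^3) (at x)"
        using ch by (auto intro!: derivative_eq_intros simp: field_simps power2_eq_square power3_eq_cube)
      have "1 - (tanh x)\<^sup>2 = 1 / (cosh x)\<^sup>2"
      proof -
        have "1 - (tanh x)\<^sup>2 = ((cosh x)\<^sup>2 - (sinh x)\<^sup>2) / (cosh x)\<^sup>2"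
          using ch by (simp add: tanh_def power_divide diff_divide_distrib)
        then show ?thesis by (simp only: hyperbolic_pythagoras)
      qed
      then have "((\<lambda>t. tanh t - t / (cosh t)\<^sup>2) has_real_derivative 2 * x * sinh x / (cosh x)^3) (at x)"
        using DERIV_diff[OF d2 d3] by simp
      then have "(W has_real_derivative
          - (2 * h * r * sinh x / (cosh x)\<^sup>2) + r\<^sup>2 * (2 * x * sinh x / (cosh x)^3)) (at x)"
        unfolding W_def by (intro DERIV_add d1 DERIV_cmult)
      moreover have "- (2 * h * r * sinh x / (cosh x)\<^sup>2) + r\<^sup>2 * (2 * x * sinh x / (cosh x)^3)
          = 2 * r\<^sup>2 * sinh x / (cosh x)\<^sup>2 * (x / cosh x - \<tau> / cosh \<tau>)"
        unfolding h using ch by (simp add: field_simps power2_eq_square power3_eq_cube)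
      moreover have "\<dots> \<ge> 0"
        using ge x \<tau> r by (intro mult_nonneg_nonneg divide_nonneg_nonneg) auto
      ultimately show "\<exists>y. (W has_real_derivative y) (at x) \<and> 0 \<le> y" by metis
    qed
  next
    case False
    have t: "t \<ge> 1"
    proof (rule ccontr)
      assume "\<not> t \<ge> 1"
      then have "\<tau> / cosh \<tau> \<le> t / cosh t"
        using div_cosh_strict_mono[of \<tau> t] \<tau> by (cases "\<tau> = t") auto
      then show False using False by simp
    qed
    \<comment> \<open>Past the second crossing, \<open>t / cosh t < h / r\<close>, both sides are
      compared with the Goldschmidt value: \<open>W \<tau> \<le> r^2\<close> by the assumption on
      \<open>\<tau>\<close>, and replacing \<open>h / r\<close> by the smaller
      \<open>t / cosh t\<close> in \<open>W t\<close> leaves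
      \<open>r^2 (tanh t + t / (cosh t)^2)\<close>, which is at least \<open>r^2\<close> because
      \<open>t \<ge> 1\<close>.\<close>
    have "W \<tau> = r\<^sup>2 * (tanh \<tau> + \<tau> / (cosh \<tau>)\<^sup>2)"
      unfolding W_def h by (simp add: power2_eq_square algebra_simps)
    also have "\<dots> \<le> r\<^sup>2 * 1"
      using one_le_tanh_plus_iff(1)[of \<tau>] \<tau> by (intro mult_left_mono) auto
    also have "\<dots> \<le> r\<^sup>2 * (tanh t + t / (cosh t)\<^sup>2)"
    proof (rule mult_left_mono)
      have "exp (- 2 * t) < 1" using t by simp
      then have "\<not> 2 * t \<le> 1 + exp (- 2 * t)" using t by linarith
      then show "1 \<le> tanh t + t / (cosh t)\<^sup>2" using one_le_tanh_plus_iff(1)[of t] by linarith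
    qed simp
    also have "\<dots> \<le> W t"
    proof -
      have "2 * r\<^sup>2 * (t / cosh t) / cosh t \<le> 2 * r\<^sup>2 * (\<tau> / cosh \<tau>) / cosh t"
        using False by (intro divide_right_mono mult_left_mono) auto
      then show ?thesis
        unfolding W_def h by (simp add: power2_eq_square algebra_simps)
    qed
    finally show ?thesis .
  qed
  then show ?thesis using W \<tau> by simp
qed

text \<open>Here \<open>t = 1 / Xi\<close>. The equation for \<open>Xi\<close> becomes
  \<open>2 t - exp (- 2 t) = 1\<close>, whose left side is strictly increasing; this makes the
  description by \<open>THE\<close> legitimate.\<close>

lemma omega_form:
  obtains t where "0 < t" "t < 1" "2 * t = 1 + exp (- 2 * t)" "omega = t / cosh t"
proof -
  define m where "m = (\<lambda>t::real. 2 * t - exp (- 2 * t))"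
  have mono: "m s < m t" if "s < t" for s t
  proof -
    have "exp (- 2 * t) < exp (- 2 * s)" using that by simp
    then show ?thesis using that unfolding m_def by linarith
  qed
  have "exp (- 2 :: real) < 1" by simp
  then have "m 1 \<ge> 1" by (simp add: m_def)
  moreover have "m 0 \<le> 1" by (simp add: m_def)
  moreover have "continuous_on {0..1} m" unfolding m_def by (intro continuous_intros)
  ultimately obtain t where t: "0 \<le> t" "t \<le> 1" "m t = 1" using IVT'[of m 0 1 1] by auto
  have "t \<noteq> 0" using t(3) by (auto simp: m_def)
  moreover have "t \<noteq> 1" using t(3) \<open>exp (- 2 :: real) < 1\<close> by (auto simp: m_def)
  ultimately have t01: "0 < t" "t < 1" using t by auto
  have char: "\<xi> * tanh (1 / \<xi>) + 1 / (cosh (1 / \<xi>))\<^sup>2 = \<xi> \<longleftrightarrow> 1 / \<xi> = t" if "\<xi> > 0" for \<xi> :: real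
  proof -
    have "\<xi> * tanh (1 / \<xi>) + 1 / (cosh (1 / \<xi>))\<^sup>2 = \<xi> * (tanh (1 / \<xi>) + (1 / \<xi>) / (cosh (1 / \<xi>))\<^sup>2)"
      using that by (simp add: field_simps)
    then have "\<xi> * tanh (1 / \<xi>) + 1 / (cosh (1 / \<xi>))\<^sup>2 = \<xi>
        \<longleftrightarrow> tanh (1 / \<xi>) + (1 / \<xi>) / (cosh (1 / \<xi>))\<^sup>2 = 1"
      using that by simp
    also have "\<dots> \<longleftrightarrow> m (1 / \<xi>) = 1"
      unfolding one_le_tanh_plus_iff(2) m_def by auto
    also have "\<dots> \<longleftrightarrow> 1 / \<xi> = t"
      using mono[of "1 / \<xi>" t] mono[of t "1 / \<xi>"] t(3) by (cases "1 / \<xi>" t rule: linorder_cases) auto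
    finally show ?thesis .
  qed
  have "Xi = 1 / t"
    unfolding Xi_def
  proof (rule the_equality)
    show "1 / t > 0 \<and> 1 / t * tanh (1 / (1 / t)) + 1 / (cosh (1 / (1 / t)))\<^sup>2 = 1 / t"
      using char[of "1 / t"] t01 by simp
    fix \<xi> :: real assume "\<xi> > 0 \<and> \<xi> * tanh (1 / \<xi>) + 1 / (cosh (1 / \<xi>))\<^sup>2 = \<xi>"
    then have "1 / \<xi> = t" using char[of \<xi>] by blast
    then show "\<xi> = 1 / t" by auto
  qed
  then have "omega = t / cosh t" unfolding omega_def by (elim ssubst) simp
  then show ?thesis using that t01 t(3) by (simp add: m_def)
qed

text \<open>With \<open>t = h / P\<close> the equation \<open>r = P cosh (h / P)\<close> reads
  \<open>t / cosh t = h / r\<close>. The largest \<open>P\<close> is the smallest \<open>t\<close>,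
  the one on the increasing branch, which does not exceed the root belonging to
  \<open>omega\<close>.\<close>

lemma Pi0_form:
  fixes h r :: real
  assumes h: "h > 0" and r: "r > 0" and le: "h / r \<le> omega"
  obtains \<tau> where "0 < \<tau>" "2 * \<tau> \<le> 1 + exp (- 2 * \<tau>)" "h = r * (\<tau> / cosh \<tau>)"
    "Pi0 h r = r / cosh \<tau>" "Pi0 h r = h / \<tau>"
proof -
  obtain t where t: "0 < t" "t < 1" "2 * t = 1 + exp (- 2 * t)" "omega = t / cosh t"
    by (rule omega_form)
  have "continuous_on {0..t} (\<lambda>t. t / cosh t)"
    by (intro continuous_intros) (metis cosh_real_nonzero)
  then obtain \<tau> where \<tau>: "0 \<le> \<tau>" "\<tau> \<le> t" "\<tau> / cosh \<tau> = h / r"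
    using IVT'[of "\<lambda>t. t / cosh t" 0 "h / r" t] t le h r by auto
  have \<tau>0: "\<tau> > 0" using \<tau> h r by (cases "\<tau> = 0") auto
  have hr: "h = r * (\<tau> / cosh \<tau>)" using \<tau>(3) r by simp
  have "exp (- 2 * t) \<le> exp (- 2 * \<tau>)" using \<tau> by simp
  then have two: "2 * \<tau> \<le> 1 + exp (- 2 * \<tau>)" using t \<tau> by linarith
  have "Pi0 h r = h / \<tau>"
    unfolding Pi0_def
  proof (rule Greatest_equality)
    show "h / \<tau> > 0 \<and> r = h / \<tau> * cosh (h / (h / \<tau>))"
      using h \<tau>0 r by (simp add: hr)
    fix y assume y: "y > 0 \<and> r = y * cosh (h / y)"
    then have e: "(h / y) / cosh (h / y) = h / r" by (simp add: field_simps)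
    have "\<not> h / y < \<tau>"
    proof
      assume "h / y < \<tau>"
      then have "(h / y) / cosh (h / y) < \<tau> / cosh \<tau>"
        using div_cosh_strict_mono[of "h / y" \<tau>] h y \<tau> t by simp
      then show False using e \<tau>(3) by linarith
    qed
    then show "y \<le> h / \<tau>" using y \<tau>0 by (simp add: field_simps)
  qed
  then show ?thesis using that[OF \<tau>0 two hr] hr \<tau>0 by simp
qed

section \<open>Lower bound of the energy\<close>

text \<open>Lebesgue differentiation: the averages over \<open>[x, x + k]\<close> vanish and tend to
  \<open>d x\<close> for almost every \<open>x\<close>. The end points join the null set, so that
  \<open>[x, x + k]\<close> stays inside for small \<open>k\<close>.\<close>

lemma ae_zero_of_integral_zero:
  fixes d :: "real \<Rightarrow> real"
  assumes d: "d integrable_on {u..v}" and zero: "\<And>x. x \<in> {u..v} \<Longrightarrow> integral {u..x} d = 0"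
  shows "negligible {x \<in> {u..v}. d x \<noteq> 0}"
proof -
  define D where "D = (\<lambda>x. if x \<in> {u..v} then d x else 0)"
  have "D integrable_on UNIV"
    unfolding D_def using d by (simp only: integrable_restrict_UNIV)
  then have Dint: "D integrable_on cbox x y" for x y
    by (rule integrable_on_subcbox) simp
  obtain N where N: "negligible N"
    "\<And>x e. \<lbrakk>x \<notin> N; 0 < e\<rbrakk> \<Longrightarrow> \<exists>\<delta>>0. \<forall>k. 0 < k \<and> k < \<delta> \<longrightarrow>
        norm (integral (cbox x (x + k *\<^sub>R One)) D /\<^sub>R k ^ DIM(real) - D x) < e"
    using integrable_ccontinuous_explicit[of D] Dint by metis
  have "{x \<in> {u..v}. d x \<noteq> 0} \<subseteq> N \<union> {u, v}"
  proof (rule ccontr)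
    assume "\<not> ?thesis"
    then obtain x where "x \<in> {u..v}" "x \<noteq> u" "x \<noteq> v" and dx: "d x \<noteq> 0" "x \<notin> N" by blast
    then have x: "u < x" "x < v" "d x \<noteq> 0" "x \<notin> N" by auto
    obtain \<delta> where \<delta>: "\<delta> > 0" "\<And>k. 0 < k \<Longrightarrow> k < \<delta> \<Longrightarrow>
        norm (integral (cbox x (x + k *\<^sub>R One)) D /\<^sub>R k ^ DIM(real) - D x) < \<bar>d x\<bar>"
      using N(2)[OF x(4), of "\<bar>d x\<bar>"] x(3) by auto
    define k where "k = min (\<delta> / 2) (v - x)"
    have k: "0 < k" "k < \<delta>" "x + k \<le> v" using \<delta>(1) x by (auto simp: k_def)
    have "integral {x..x + k} D = integral {x..x + k} d"
      using x k by (intro Henstock_Kurzweil_Integration.integral_cong) (auto simp: D_def)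
    moreover have "integral {u..x} d + integral {x..x + k} d = integral {u..x + k} d"
      using x k by (intro Henstock_Kurzweil_Integration.integral_combine integrable_subinterval_real[OF d]) auto
    ultimately have "integral {x..x + k} D = 0"
      using zero[of x] zero[of "x + k"] x k by simp
    then have "norm (- D x) < \<bar>d x\<bar>" using \<delta>(2)[OF k(1,2)] by simp
    then show False using x by (simp add: D_def)
  qed
  moreover have "negligible (N \<union> {u, v})" using N(1) by simp
  ultimately show ?thesis by (rule negligible_subset[rotated])
qed

lemma ae_zero_of_nonneg_integral_zero:
  fixes e :: "real \<Rightarrow> real"
  assumes e: "(e has_integral 0) {u..v}" and nonneg: "\<And>x. x \<in> {u..v} \<Longrightarrow> 0 \<le> e x"
  shows "negligible {x \<in> {u..v}. e x \<noteq> 0}"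
proof (rule ae_zero_of_integral_zero)
  show int: "e integrable_on {u..v}" using e by blast
  fix x assume x: "x \<in> {u..v}"
  have sub: "e integrable_on {u..x}" by (rule integrable_subinterval_real[OF int]) (use x in auto)
  have "integral {u..x} e \<le> integral {u..v} e"
    by (rule integral_subset_le) (use x sub int nonneg in auto)
  moreover have "0 \<le> integral {u..x} e"
    by (rule Henstock_Kurzweil_Integration.integral_nonneg[OF sub]) (use nonneg x in auto)
  ultimately show "integral {u..x} e = 0" using integral_unique[OF e] by simp
qed

section \<open>Calculus for functions in W^{1,1}\<close>

context
  fixes h :: real and \<rho> g :: "real \<Rightarrow> real"
  assumes W: "W11_deriv h \<rho> g"
begin

lemma W11_integrable: "g absolutely_integrable_on {-h..h}"
  using W by (simp add: W11_deriv_def)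

lemma W11_deriv_eq: "x \<in> {-h..h} \<Longrightarrow> \<rho> x = \<rho> (- h) + integral {-h..x} g"
  using W unfolding W11_deriv_def by blast

lemma W11_sub_integrable:
  assumes "-h \<le> u" "v \<le> h"
  shows "g integrable_on {u..v}" and "(\<lambda>x. \<bar>g x\<bar>) integrable_on {u..v}"
proof -
  have "g integrable_on {-h..h}" "(\<lambda>x. \<bar>g x\<bar>) integrable_on {-h..h}"
    using W11_integrable by (auto simp: absolutely_integrable_on_def)
  then show "g integrable_on {u..v}" "(\<lambda>x. \<bar>g x\<bar>) integrable_on {u..v}"
    using assms by (auto elim!: integrable_subinterval_real)
qed

lemma W11_increment:
  assumes "-h \<le> u" "u \<le> v" "v \<le> h"
  shows "\<rho> v - \<rho> u = integral {u..v} g"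
proof -
  have "\<rho> v = \<rho> (- h) + integral {-h..v} g" "\<rho> u = \<rho> (- h) + integral {-h..u} g"
    by (rule W11_deriv_eq, use assms in simp)+
  moreover have "integral {-h..u} g + integral {u..v} g = integral {-h..v} g"
    using assms by (intro Henstock_Kurzweil_Integration.integral_combine W11_sub_integrable) auto
  ultimately show ?thesis by simp
qed

lemma W11_continuous: "continuous_on {-h..h} \<rho>"
proof -
  have "continuous_on {-h..h} (\<lambda>x. \<rho> (- h) + integral {-h..x} g)"
    by (intro continuous_intros indefinite_integral_continuous_1 W11_sub_integrable) auto
  then show ?thesis
    by (rule continuous_on_eq) (rule W11_deriv_eq[symmetric])
qed

lemma W11_mult_integrable:
  assumes "continuous_on {-h..h} \<psi>"
  shows "(\<lambda>x. \<psi> x * g x) absolutely_integrable_on {-h..h}"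
proof (rule absolutely_integrable_bounded_measurable_product_real)
  show "\<psi> \<in> borel_measurable (lebesgue_on {-h..h})"
    by (rule continuous_imp_measurable_on_sets_lebesgue[OF assms]) simp
  show "bounded (\<psi> ` {-h..h})"
    by (rule compact_imp_bounded[OF compact_continuous_image[OF assms]]) simp
qed (use W11_integrable in auto)

text \<open>On short intervals both sides agree up to a small multiple of the variation of \<open>\<rho>\<close>, and this
  estimate is additive.\<close>

lemma W11_chain_rule:
  assumes range: "\<And>x. x \<in> {-h..h} \<Longrightarrow> \<rho> x \<in> {m..M}"
    and \<Phi>: "\<And>s. s \<in> {m..M} \<Longrightarrow> (\<Phi> has_real_derivative \<phi> s) (at s within {m..M})"
    and \<phi>: "continuous_on {m..M} \<phi>"
    and uv: "-h \<le> u" "u \<le> v" "v \<le> h"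
  shows "((\<lambda>x. \<phi> (\<rho> x) * g x) has_integral \<Phi> (\<rho> v) - \<Phi> (\<rho> u)) {u..v}"
proof -
  have cont: "continuous_on {-h..h} (\<lambda>x. \<phi> (\<rho> x))"
    by (rule continuous_on_compose2[OF \<phi> W11_continuous]) (use range in auto)
  have "(\<lambda>x. \<phi> (\<rho> x) * g x) integrable_on {-h..h}"
    using W11_mult_integrable[OF cont] by (simp add: absolutely_integrable_on_def)
  then have int: "(\<lambda>x. \<phi> (\<rho> x) * g x) integrable_on {x..y}" if "-h \<le> x" "y \<le> h" for x y
    by (rule integrable_subinterval_real) (use that in auto)
  define E where "E = (\<lambda>x y. \<Phi> (\<rho> y) - \<Phi> (\<rho> x) - integral {x..y} (\<lambda>x. \<phi> (\<rho> x) * g x))"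
  have est: "\<bar>E u v\<bar> \<le> e * integral {u..v} (\<lambda>x. \<bar>g x\<bar>)" if e: "e > 0" for e
  proof -
    define P where "P = (\<lambda>x y. -h \<le> x \<and> y \<le> h \<longrightarrow> \<bar>E x y\<bar> \<le> e * integral {x..y} (\<lambda>x. \<bar>g x\<bar>))"
    have "P u v"
    proof (rule Bolzano[OF uv(2)])
      fix x y z assume P: "P x y" "P y z" "x \<le> y" "y \<le> z"
      show "P x z"
        unfolding P_def
      proof
        assume xz: "-h \<le> x \<and> z \<le> h"
        have "E x z = E x y + E y z"
          unfolding E_def
          using Henstock_Kurzweil_Integration.integral_combine[of x y z "\<lambda>x. \<phi> (\<rho> x) * g x"] int xz P by simp
        moreover have "integral {x..z} (\<lambda>x. \<bar>g x\<bar>) = integral {x..y} (\<lambda>x. \<bar>g x\<bar>) + integral {y..z} (\<lambda>x. \<bar>g x\<bar>)"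
          using Henstock_Kurzweil_Integration.integral_combine[of x y z "\<lambda>x. \<bar>g x\<bar>"] W11_sub_integrable xz P by simp
        moreover have "\<bar>E x y\<bar> \<le> e * integral {x..y} (\<lambda>x. \<bar>g x\<bar>)" "\<bar>E y z\<bar> \<le> e * integral {y..z} (\<lambda>x. \<bar>g x\<bar>)"
          using P xz by (auto simp: P_def)
        ultimately show "\<bar>E x z\<bar> \<le> e * integral {x..z} (\<lambda>x. \<bar>g x\<bar>)"
          by (simp add: distrib_left)
      qed
    next
      fix x assume x: "u \<le> x" "x \<le> v"
      then have xh: "x \<in> {-h..h}" using uv by auto
      define k where "k = \<phi> (\<rho> x)"
      obtain \<eta> where \<eta>: "\<eta> > 0" "\<And>s. s \<in> {m..M} \<Longrightarrow> dist s (\<rho> x) < \<eta> \<Longrightarrow> dist (\<phi> s) k < e / 2"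
        using \<phi> range[OF xh] e unfolding continuous_on_iff k_def by (metis half_gt_zero)
      obtain \<delta> where \<delta>: "\<delta> > 0" "\<And>t. t \<in> {-h..h} \<Longrightarrow> dist t x < \<delta> \<Longrightarrow> dist (\<rho> t) (\<rho> x) < \<eta>"
        using W11_continuous xh \<eta>(1) unfolding continuous_on_iff by metis
      have "P y z" if yz: "y \<le> x" "x \<le> z" "z - y < \<delta>" for y z
        unfolding P_def
      proof
        assume h: "-h \<le> y \<and> z \<le> h"
        have near: "t \<in> {-h..h}" "\<rho> t \<in> {m..M}" "dist (\<rho> t) (\<rho> x) < \<eta>" if "y \<le> t" "t \<le> z" for t
          using that yz h \<delta>(2)[of t] range[of t] by (auto simp: dist_real_def)
        define V where "V = integral {y..z} (\<lambda>x. \<bar>g x\<bar>)"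
        note gi = W11_sub_integrable[of y z]
        have 1: "\<bar>\<rho> z - \<rho> y\<bar> \<le> V"
          using W11_increment[of y z] yz h gi integral_norm_bound_integral[of g "{y..z}" "\<lambda>x. \<bar>g x\<bar>"]
          by (simp add: V_def)
        have mv: "\<bar>\<Phi> t - \<Phi> s - k * (t - s)\<bar> \<le> e / 2 * (t - s)"
          if "s \<le> t" "s \<in> {m..M}" "t \<in> {m..M}" "dist s (\<rho> x) < \<eta>" "dist t (\<rho> x) < \<eta>" for s t
        proof -
          have "\<exists>\<xi>\<in>{s..t}. \<Phi> t - \<Phi> s = (\<lambda>d. \<phi> \<xi> * d) (t - s)"
          proof (rule mvt_very_simple[OF that(1)])
            fix \<xi> assume "s \<le> \<xi>" "\<xi> \<le> t"
            then show "(\<Phi> has_derivative (\<lambda>d. \<phi> \<xi> * d)) (at \<xi> within {s..t})"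
              using \<Phi>[of \<xi>] that by (auto simp: has_field_derivative_def intro: has_derivative_subset)
          qed
          then obtain \<xi> where \<xi>: "s \<le> \<xi>" "\<xi> \<le> t" "\<Phi> t - \<Phi> s = \<phi> \<xi> * (t - s)" by auto
          have "dist (\<phi> \<xi>) k < e / 2"
            using \<eta>(2)[of \<xi>] \<xi> that by (auto simp: dist_real_def)
          then have "\<bar>\<phi> \<xi> - k\<bar> * (t - s) \<le> e / 2 * (t - s)"
            using that by (intro mult_right_mono) (auto simp: dist_real_def)
          moreover have "\<Phi> t - \<Phi> s - k * (t - s) = (\<phi> \<xi> - k) * (t - s)"
            using \<xi>(3) by (simp add: algebra_simps)
          ultimately show ?thesis using that(1) by (simp add: abs_mult)
        qed
        have "\<bar>\<Phi> (\<rho> z) - \<Phi> (\<rho> y) - k * (\<rho> z - \<rho> y)\<bar> \<le> e / 2 * \<bar>\<rho> z - \<rho> y\<bar>"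
        proof (cases "\<rho> y \<le> \<rho> z")
          case True
          then show ?thesis using mv[of "\<rho> y" "\<rho> z"] near[of y] near[of z] yz by simp
        next
          case False
          have "\<Phi> (\<rho> z) - \<Phi> (\<rho> y) - k * (\<rho> z - \<rho> y) = - (\<Phi> (\<rho> y) - \<Phi> (\<rho> z) - k * (\<rho> y - \<rho> z))"
            by (simp add: algebra_simps)
          then show ?thesis using False mv[of "\<rho> z" "\<rho> y"] near[of y] near[of z] yz
            by (simp only: abs_minus_cancel) (simp add: abs_if)
        qed
        also have "\<dots> \<le> e / 2 * V" using 1 e by (intro mult_left_mono) auto
        finally have 2: "\<bar>\<Phi> (\<rho> z) - \<Phi> (\<rho> y) - k * (\<rho> z - \<rho> y)\<bar> \<le> e / 2 * V" .
        have "norm (integral {y..z} (\<lambda>t. k * g t - \<phi> (\<rho> t) * g t)) \<le> integral {y..z} (\<lambda>t. e / 2 * \<bar>g t\<bar>)"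
        proof (rule integral_norm_bound_integral)
          fix t assume "t \<in> {y..z}"
          then have "dist (\<phi> (\<rho> t)) k < e / 2" using near[of t] \<eta>(2) by simp
          then have "\<bar>k - \<phi> (\<rho> t)\<bar> * \<bar>g t\<bar> \<le> e / 2 * \<bar>g t\<bar>"
            by (intro mult_right_mono) (auto simp: dist_real_def abs_minus_commute)
          then show "norm (k * g t - \<phi> (\<rho> t) * g t) \<le> e / 2 * \<bar>g t\<bar>"
            by (simp add: left_diff_distrib flip: abs_mult)
        qed (use gi h int[of y z] in \<open>auto intro!: integrable_diff integrable_on_mult_right\<close>)
        also have "integral {y..z} (\<lambda>t. e / 2 * \<bar>g t\<bar>) = e / 2 * V"
          unfolding V_def by (rule integral_mult_right)
        also have "integral {y..z} (\<lambda>t. k * g t - \<phi> (\<rho> t) * g t)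
            = integral {y..z} (\<lambda>t. k * g t) - integral {y..z} (\<lambda>t. \<phi> (\<rho> t) * g t)"
          using gi h int[of y z] by (intro Henstock_Kurzweil_Integration.integral_diff integrable_on_mult_right) auto
        also have "integral {y..z} (\<lambda>t. k * g t) = k * (\<rho> z - \<rho> y)"
          using W11_increment[of y z] yz h by simp
        finally have 3: "\<bar>k * (\<rho> z - \<rho> y) - integral {y..z} (\<lambda>t. \<phi> (\<rho> t) * g t)\<bar> \<le> e / 2 * V" by simp
        show "\<bar>E y z\<bar> \<le> e * integral {y..z} (\<lambda>x. \<bar>g x\<bar>)"
          using 2 3 unfolding E_def V_def[symmetric] by linarith
      qed
      then show "\<exists>d>0. \<forall>y z. y \<le> x \<and> x \<le> z \<and> z - y < d \<longrightarrow> P y z"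
        using \<delta>(1) by blast
    qed
    then show ?thesis using uv by (simp add: P_def)
  qed
  have "\<bar>E u v\<bar> \<le> 0"
  proof (rule field_le_epsilon)
    fix e :: real assume e: "e > 0"
    define V where "V = integral {u..v} (\<lambda>x. \<bar>g x\<bar>)"
    have V: "V \<ge> 0"
      unfolding V_def by (rule Henstock_Kurzweil_Integration.integral_nonneg) (use W11_sub_integrable uv in auto)
    have "\<bar>E u v\<bar> \<le> e / (V + 1) * V"
      using est[of "e / (V + 1)"] e V by (simp add: V_def)
    also have "\<dots> \<le> e" using e V by (simp add: field_simps)
    finally show "\<bar>E u v\<bar> \<le> 0 + e" by simp
  qed
  then have "integral {u..v} (\<lambda>x. \<phi> (\<rho> x) * g x) = \<Phi> (\<rho> v) - \<Phi> (\<rho> u)"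
    by (simp add: E_def)
  then show ?thesis using int[of u v] uv by (metis integrable_integral)
qed

end

text \<open>Makes the choice in \<open>wderiv\<close> harmless: for an extremal it may be replaced
  by the explicit derivative \<open>pos_inv\<close>.\<close>

lemma W11_deriv_unique:
  assumes "W11_deriv h \<rho> f" "W11_deriv h \<rho> g"
  shows "negligible {x \<in> {-h..h}. f x \<noteq> g x}"
proof -
  have "negligible {x \<in> {-h..h}. f x - g x \<noteq> 0}"
  proof (rule ae_zero_of_integral_zero)
    show "(\<lambda>x. f x - g x) integrable_on {-h..h}"
      using W11_sub_integrable[OF assms(1)] W11_sub_integrable[OF assms(2)] by (intro integrable_diff) auto
    fix x assume x: "x \<in> {-h..h}"
    then have "integral {-h..x} f = integral {-h..x} g"
      using W11_increment[OF assms(1), of "-h" x] W11_increment[OF assms(2), of "-h" x] by auto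
    then show "integral {-h..x} (\<lambda>x. f x - g x) = 0"
      using W11_sub_integrable[OF assms(1), of "-h" x] W11_sub_integrable[OF assms(2), of "-h" x] x
      by (simp add: Henstock_Kurzweil_Integration.integral_diff)
  qed
  then show ?thesis by simp
qed

section \<open>The energy and its calibration\<close>

lemma W11_deriv_wderiv: "\<rho> \<in> Xset h r \<Longrightarrow> W11_deriv h \<rho> (wderiv h \<rho>)"
  unfolding Xset_def W11_def wderiv_def by (simp add: someI_ex)

lemma Energy_lagr: "Energy h c \<rho> = integral {-h..h} (\<lambda>x. lagr c (\<rho> x) (wderiv h \<rho> x))"
  by (simp add: Energy_def lagr_def)

text \<open>The Lagrangian is at most \<open>s + (s + c / s) |p|\<close>, and along a positive
  continuous \<open>\<rho>\<close> the coefficients are continuous on a compact interval. So the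
  integral in \<open>Energy\<close> is a genuine one and not the default value
  \<open>0\<close>.\<close>

lemma lagr_integrable:
  assumes W: "W11_deriv h \<rho> g" and c: "c \<ge> 0" and pos: "\<And>x. x \<in> {-h..h} \<Longrightarrow> \<rho> x > 0"
  shows "(\<lambda>x. lagr c (\<rho> x) (g x)) integrable_on {-h..h}"
proof -
  have gm: "g \<in> borel_measurable (lebesgue_on {-h..h})"
    using W11_integrable[OF W] by (rule absolutely_integrable_imp_borel_measurable) simp
  have \<rho>m: "\<rho> \<in> borel_measurable (lebesgue_on {-h..h})"
    by (rule continuous_imp_measurable_on_sets_lebesgue[OF W11_continuous[OF W]]) simp
  have i\<rho>: "continuous_on {-h..h} (\<lambda>x. \<rho> x + c / \<rho> x)"
    by (intro continuous_intros W11_continuous[OF W]) (use pos in force)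
  have "(\<lambda>x. lagr c (\<rho> x) (g x)) absolutely_integrable_on {-h..h}"
  proof (rule measurable_bounded_by_integrable_imp_absolutely_integrable)
    show "(\<lambda>x. lagr c (\<rho> x) (g x)) \<in> borel_measurable (lebesgue_on {-h..h})"
      unfolding lagr_def
      by (intro borel_measurable_add borel_measurable_times borel_measurable_divide borel_measurable_power
          borel_measurable_const gm \<rho>m borel_measurable_sqrt measurable_compose[OF _ borel_measurable_sqrt])
    show "(\<lambda>x. \<rho> x + \<bar>(\<rho> x + c / \<rho> x) * g x\<bar>) integrable_on {-h..h}"
      using W11_mult_integrable[OF W i\<rho>]
      by (intro integrable_add integrable_continuous_real[OF W11_continuous[OF W]])
         (simp add: absolutely_integrable_on_def)
    fix x assume x: "x \<in> {-h..h}"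
    define s p w where "s = \<rho> x" and "p = g x" and "w = sqrt (1 + p\<^sup>2)"
    have s: "s > 0" using pos x by (simp add: s_def)
    have w: "w > 0" "\<bar>p\<bar> < w" using sqrt_facts[of p] by (auto simp: w_def)
    have "w \<le> 1 + \<bar>p\<bar>" unfolding w_def by (rule real_le_lsqrt) (auto simp: power2_eq_square algebra_simps)
    then have "s * w \<le> s * (1 + \<bar>p\<bar>)" using s by (intro mult_left_mono) auto
    moreover have "c * p\<^sup>2 / (s * w) \<le> c / s * \<bar>p\<bar>"
    proof -
      have "\<bar>p\<bar> * \<bar>p\<bar> \<le> \<bar>p\<bar> * w" using w by (intro mult_left_mono) auto
      then have "p\<^sup>2 \<le> \<bar>p\<bar> * w" by (simp add: power2_eq_square)
      then have "c / s * (p\<^sup>2 / w) \<le> c / s * \<bar>p\<bar>"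
        using c s w by (intro mult_left_mono) (auto simp: pos_divide_le_eq)
      then show ?thesis by simp
    qed
    ultimately have "lagr c s p \<le> s + (s + c / s) * \<bar>p\<bar>"
      by (simp add: lagr_def w_def distrib_left distrib_right)
    moreover have "0 \<le> lagr c s p"
      unfolding lagr_def using s c by (intro add_nonneg_nonneg divide_nonneg_nonneg mult_nonneg_nonneg) auto
    moreover have "s + c / s \<ge> 0" using s c by simp
    ultimately show "norm (lagr c (\<rho> x) (g x)) \<le> \<rho> x + \<bar>(\<rho> x + c / \<rho> x) * g x\<bar>"
      by (simp add: s_def p_def abs_mult)
  qed simp
  then show ?thesis by (simp add: absolutely_integrable_on_def)
qed

text \<open>By the chain rule \<open>phi c a (\<rho>) \<rho>'\<close> integrates to the increment of
  a primitive \<open>\<Phi>\<close>, from \<open>r\<close> down to \<open>a\<close> on the left of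
  \<open>x0\<close> and back on the right. With the fixed sign \<open>\<epsilon>\<close> in place of
  the absolute value the gap is an exact identity, even if \<open>\<rho>\<close> oscillates.\<close>

lemma energy_gap:
  assumes X: "\<rho> \<in> Xset h r" and c: "c \<ge> 0" and h: "h > 0"
    and x0: "x0 \<in> {-h..h}" "\<And>x. x \<in> {-h..h} \<Longrightarrow> a \<le> \<rho> x" "\<rho> x0 = a"
  defines "\<epsilon> \<equiv> \<lambda>x. if x < x0 then - 1 else (1::real)"
  shows "((\<lambda>x. lagr c (\<rho> x) (wderiv h \<rho> x) - a - phi c a (\<rho> x) * (\<epsilon> x * wderiv h \<rho> x))
      has_integral Energy h c \<rho> - val h r c a) {-h..h}"
proof -
  define g where "g = wderiv h \<rho>"
  note W = W11_deriv_wderiv[OF X, folded g_def]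
  have a: "a > 0" and bd: "\<rho> (- h) = r" "\<rho> h = r" and pos: "\<And>x. x \<in> {-h..h} \<Longrightarrow> \<rho> x > 0"
    using X x0 h by (auto simp: Xset_def)
  have "compact (\<rho> ` {-h..h})"
    by (rule compact_continuous_image[OF W11_continuous[OF W]]) simp
  then obtain M where M: "\<And>x. x \<in> {-h..h} \<Longrightarrow> \<rho> x \<le> M"
    using compact_imp_bounded bounded_imp_bdd_above unfolding bdd_above_def by (metis image_eqI)
  define \<Phi> where "\<Phi> = (\<lambda>s. integral {a..s} (phi c a))"
  have phc: "continuous_on {a..M} (phi c a)"
    by (rule continuous_on_subset[OF continuous_on_phi[OF c a]]) auto
  have chain: "((\<lambda>x. phi c a (\<rho> x) * g x) has_integral \<Phi> (\<rho> v) - \<Phi> (\<rho> u)) {u..v}"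
    if "-h \<le> u" "u \<le> v" "v \<le> h" for u v
  proof (rule W11_chain_rule[OF W _ _ phc that])
    show "\<rho> x \<in> {a..M}" if "x \<in> {-h..h}" for x using x0(2) M that by auto
    show "(\<Phi> has_real_derivative phi c a s) (at s within {a..M})" if "s \<in> {a..M}" for s
      unfolding \<Phi>_def by (rule integral_has_real_derivative[OF phc that])
  qed
  have "((\<lambda>x. - (phi c a (\<rho> x) * g x)) has_integral - (\<Phi> (\<rho> x0) - \<Phi> (\<rho> (- h)))) {-h..x0}"
    using x0(1) by (intro has_integral_neg chain) auto
  then have "((\<lambda>x. - (phi c a (\<rho> x) * g x)) has_integral \<Phi> r) {-h..x0}"
    by (simp add: bd x0(3) \<Phi>_def)
  then have L: "((\<lambda>x. phi c a (\<rho> x) * (\<epsilon> x * g x)) has_integral \<Phi> r) {-h..x0}"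
    by (rule has_integral_spike[of "{x0}", rotated 2]) (auto simp: \<epsilon>_def)
  have R: "((\<lambda>x. phi c a (\<rho> x) * (\<epsilon> x * g x)) has_integral \<Phi> r) {x0..h}"
    using chain[of x0 h] x0(1)
    by (subst has_integral_cong[where g = "\<lambda>x. phi c a (\<rho> x) * g x"])
       (auto simp: \<epsilon>_def bd x0(3) \<Phi>_def)
  have 1: "((\<lambda>x. phi c a (\<rho> x) * (\<epsilon> x * g x)) has_integral \<Phi> r + \<Phi> r) {-h..h}"
    using x0(1) by (intro has_integral_combine[OF _ _ L R]) auto
  have 2: "((\<lambda>x. a) has_integral (2 * h) * a) {-h..h}"
    using has_integral_const_real[of a "-h" h] h by simp
  have 3: "((\<lambda>x. lagr c (\<rho> x) (g x)) has_integral Energy h c \<rho>) {-h..h}"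
    unfolding Energy_lagr g_def[symmetric]
    by (rule integrable_integral, rule lagr_integrable[OF W c pos])
  show ?thesis
    using has_integral_diff[OF has_integral_diff[OF 3 2] 1]
    by (simp add: g_def val_def \<Phi>_def algebra_simps)
qed

text \<open>The gap is the sum of two nonnegative ones: \<open>lagr - a - phi |p|\<close>, which
  measures contact, and \<open>phi (|p| - e p)\<close>, which measures direction. The second fixes
  the sign of \<open>p\<close> only where \<open>phi > 0\<close>; at \<open>s = a\<close> the
  contact slope is \<open>0\<close> anyway.\<close>

lemma energy_gap_nonneg:
  assumes c: "c \<ge> 0" and a: "0 < a" "a \<le> s" and e: "e = 1 \<or> e = - 1"
  shows "0 \<le> lagr c s p - a - phi c a s * (e * p)"
    and "lagr c s p - a - phi c a s * (e * p) = 0 \<longleftrightarrow> e * p = slope c a s"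
proof -
  have le: "phi c a s * (e * p) \<le> phi c a s * \<bar>p\<bar>"
    using phi_nonneg[of c a s] c a e by (intro mult_left_mono) auto
  then show "0 \<le> lagr c s p - a - phi c a s * (e * p)"
    using lagr_ge[of c a s p] c a by simp
  show "lagr c s p - a - phi c a s * (e * p) = 0 \<longleftrightarrow> e * p = slope c a s"
  proof
    assume *: "lagr c s p - a - phi c a s * (e * p) = 0"
    then have eq: "lagr c s p = a + phi c a s * \<bar>p\<bar>" "phi c a s * (e * p) = phi c a s * \<bar>p\<bar>"
      using lagr_ge[of c a s p] c a le by linarith+
    then have sl: "\<bar>p\<bar> = slope c a s" using lagr_eq_iff[of c a s p] c a by simp
    show "e * p = slope c a s"
    proof (cases "s = a")
      case True
      then show ?thesis using sl c a e by simp
    next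
      case False
      then show ?thesis using eq(2) sl phi_pos[of c a s] c a by simp
    qed
  next
    assume *: "e * p = slope c a s"
    then have "\<bar>p\<bar> = slope c a s" using slope_nonneg[of c a s] c a e by auto
    then show "lagr c s p - a - phi c a s * (e * p) = 0"
      using lagr_eq_iff[of c a s p] c a * by simp
  qed
qed

lemma energy_ge_val:
  assumes X: "\<rho> \<in> Xset h r" and c: "c \<ge> 0" and h: "h > 0"
    and x0: "x0 \<in> {-h..h}" "\<And>x. x \<in> {-h..h} \<Longrightarrow> a \<le> \<rho> x" "\<rho> x0 = a"
  shows "val h r c a \<le> Energy h c \<rho>"
    and "Energy h c \<rho> = val h r c a \<longleftrightarrow>
      negligible {x \<in> {-h..h}. (if x < x0 then - 1 else 1) * wderiv h \<rho> x \<noteq> slope c a (\<rho> x)}"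
proof -
  define e where "e = (\<lambda>x. lagr c (\<rho> x) (wderiv h \<rho> x) - a
      - phi c a (\<rho> x) * ((if x < x0 then - 1 else 1) * wderiv h \<rho> x))"
  have a: "a > 0" using X x0 by (auto simp: Xset_def)
  have gap: "(e has_integral Energy h c \<rho> - val h r c a) {-h..h}"
    unfolding e_def by (rule energy_gap[OF assms])
  have e0: "0 \<le> e x" "e x = 0 \<longleftrightarrow> (if x < x0 then - 1 else 1) * wderiv h \<rho> x = slope c a (\<rho> x)"
    if "x \<in> {-h..h}" for x
    unfolding e_def by (rule energy_gap_nonneg[OF c a x0(2)[OF that]], simp)+
  show "val h r c a \<le> Energy h c \<rho>"
    using has_integral_nonneg[OF gap] e0(1) by simp
  have set: "{x \<in> {-h..h}. (if x < x0 then - 1 else 1) * wderiv h \<rho> x \<noteq> slope c a (\<rho> x)} = {x \<in> {-h..h}. e x \<noteq> 0}"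
    using e0(2) by blast
  show "Energy h c \<rho> = val h r c a \<longleftrightarrow>
      negligible {x \<in> {-h..h}. (if x < x0 then - 1 else 1) * wderiv h \<rho> x \<noteq> slope c a (\<rho> x)}"
    unfolding set
  proof
    assume "Energy h c \<rho> = val h r c a"
    then show "negligible {x \<in> {-h..h}. e x \<noteq> 0}"
      using gap e0(1) by (intro ae_zero_of_nonneg_integral_zero) auto
  next
    assume N: "negligible {x \<in> {-h..h}. e x \<noteq> 0}"
    have "(e has_integral 0) {-h..h}"
      by (rule has_integral_spike[OF N _ has_integral_0]) auto
    then show "Energy h c \<rho> = val h r c a"
      using has_integral_unique[OF gap] by fastforce
  qed
qed

section \<open>Extremals\<close>

text \<open>Slope as a function of the abscissa, hence the derivative of the extremal. It is odd and
  differentiable at \<open>0\<close>, so the even extremal is obtained in one piece and not by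
  gluing two legs.\<close>

definition pos_inv :: "real \<Rightarrow> real \<Rightarrow> real \<Rightarrow> real" where
  "pos_inv c a = inv (pos c a)"

definition extremal :: "real \<Rightarrow> real \<Rightarrow> real \<Rightarrow> real" where
  "extremal c a x = ht c a (pos_inv c a x)"

context
  fixes c a :: real
  assumes c: "c \<ge> 0" and a: "a > 0"
begin

lemma pos_inv_pos: "pos_inv c a (pos c a p) = p"
proof -
  have "inj (pos c a)"
    using pos_less_iff[OF c a] by (intro linorder_injI) (metis less_irrefl)
  then show ?thesis by (simp add: pos_inv_def)
qed

lemma pos_pos_inv:
  assumes "\<bar>x\<bar> \<le> pos c a P" "P \<ge> 0"
  shows "pos c a (pos_inv c a x) = x"
proof -
  have "\<exists>p\<ge>-P. p \<le> P \<and> pos c a p = x"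
    using assms by (intro IVT' continuous_on_pos[OF c a]) (auto simp: pos_minus[OF c a])
  then show ?thesis using pos_inv_pos by auto
qed

lemma pos_inv_minus: "\<bar>x\<bar> \<le> pos c a P \<Longrightarrow> P \<ge> 0 \<Longrightarrow> pos_inv c a (- x) = - pos_inv c a x"
  using pos_pos_inv[of x P] pos_inv_pos[of "- pos_inv c a x"] by (simp add: pos_minus[OF c a])

lemma pos_inv_less:
  assumes "\<bar>x\<bar> \<le> pos c a P" "\<bar>y\<bar> \<le> pos c a P" "P \<ge> 0" "x < y"
  shows "pos_inv c a x < pos_inv c a y"
  using assms pos_pos_inv[of x P] pos_pos_inv[of y P] pos_less_iff[OF c a, of "pos_inv c a x" "pos_inv c a y"]
  by simp

lemma pos_inv_has_derivative:
  assumes x: "\<bar>x\<bar> \<le> pos c a P" and P: "P \<ge> 0"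
  shows "(pos_inv c a has_real_derivative 1 / speed c a (pos_inv c a x)) (at x)"
proof -
  \<comment> \<open>Enlarging \<open>P\<close> makes the end points
    \<open>\<plusminus> pos c a P\<close> interior, so the derivative is two-sided there as
    well.\<close>
  have lt: "pos c a P < pos c a (P + 1)" using pos_less_iff[OF c a] by simp
  have "(pos_inv c a has_real_derivative inverse (speed c a (pos_inv c a x))) (at x)"
  proof (rule DERIV_inverse_function)
    show "(pos c a has_real_derivative speed c a (pos_inv c a x)) (at (pos_inv c a x))"
      by (rule pos_has_derivative[OF c a])
    show "speed c a (pos_inv c a x) \<noteq> 0"
      using speed_pos[OF c a, of "pos_inv c a x"] by simp
    show "- pos c a (P + 1) < x" "x < pos c a (P + 1)" using x lt by auto
    show "pos c a (pos_inv c a y) = y" if "- pos c a (P + 1) < y" "y < pos c a (P + 1)" for y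
      using pos_pos_inv[of y "P + 1"] that P by simp
    have "isCont (pos_inv c a) (pos c a (pos_inv c a x))"
      by (rule isCont_inverse_function[where d = 1])
         (simp_all add: pos_inv_pos DERIV_isCont[OF pos_has_derivative[OF c a]])
    then show "isCont (pos_inv c a) x" using pos_pos_inv[OF x P] by simp
  qed
  then show ?thesis by (simp add: inverse_eq_divide)
qed

lemma extremal_has_derivative:
  assumes "\<bar>x\<bar> \<le> pos c a P" "P \<ge> 0"
  shows "(extremal c a has_real_derivative pos_inv c a x) (at x)"
  unfolding extremal_def [abs_def]
  using DERIV_chain2[OF ht_has_derivative[OF c a] pos_inv_has_derivative[OF assms]]
  by (rule DERIV_cong) (use speed_pos[OF c a, of "pos_inv c a x"] in simp)

text \<open>While \<open>\<sigma> > a\<close>, the transit of \<open>\<sigma> t\<close> grows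
  exactly at rate 1. At height \<open>a\<close> the equation
  \<open>\<sigma>' = slope c a (\<sigma>)\<close> has no uniqueness and \<open>\<sigma>\<close> may
  rest, which spends abscissa without gaining transit. Hence only an inequality, proved from the
  last point at height \<open>a\<close> onwards.\<close>

lemma transit_increment_le:
  assumes uv: "u \<le> v" and \<sigma>: "continuous_on {u..v} \<sigma>" "\<And>t. t \<in> {u..v} \<Longrightarrow> a \<le> \<sigma> t"
    and d: "\<And>t. t \<in> {u<..<v} \<Longrightarrow> (\<sigma> has_real_derivative slope c a (\<sigma> t)) (at t)"
  shows "transit c a (\<sigma> v) - transit c a (\<sigma> u) \<le> v - u"
proof (cases "\<sigma> v = a")
  case True
  then show ?thesis
    using uv transit_nonneg[OF c a \<sigma>(2)[of u]] transit_a[OF c a] by simp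
next
  case False
  have step: "transit c a (\<sigma> v) - transit c a (\<sigma> z) \<le> v - z"
    if z: "u \<le> z" "z \<le> v" "\<And>t. z < t \<Longrightarrow> t \<le> v \<Longrightarrow> \<sigma> t \<noteq> a" for z
  proof (cases "z = v")
    case False
    then have zv: "z < v" using z by simp
    have "transit c a (\<sigma> v) - v = transit c a (\<sigma> z) - z"
    proof (rule DERIV_isconst_end[OF zv])
      have "continuous_on {z..v} (\<lambda>t. transit c a (\<sigma> t))"
        by (rule continuous_on_compose2[OF continuous_on_transit[OF c a]
              continuous_on_subset[OF \<sigma>(1)]]) (use z \<sigma>(2) in auto)
      then show "continuous_on {z..v} (\<lambda>t. transit c a (\<sigma> t) - t)"
        by (intro continuous_intros)
      fix t assume t: "z < t" "t < v"
      then have s: "a < \<sigma> t" using z(3)[of t] \<sigma>(2)[of t] z(1) by force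
      have "((\<lambda>t. transit c a (\<sigma> t) - t) has_real_derivative
          1 / slope c a (\<sigma> t) * slope c a (\<sigma> t) - 1) (at t)"
        using t z(1)
        by (intro DERIV_diff DERIV_ident DERIV_chain2[OF transit_has_derivative[OF c a s] d]) auto
      then show "((\<lambda>t. transit c a (\<sigma> t) - t) has_real_derivative 0) (at t)"
        using slope_pos[OF c a s] by simp
    qed
    then show ?thesis by simp
  qed simp
  define Z where "Z = {t \<in> {u..v}. \<sigma> t = a}"
  show ?thesis
  proof (cases "Z = {}")
    case True
    then show ?thesis using step[of u] uv by (force simp: Z_def)
  next
    case nonempty: False
    have "closed Z"
      unfolding Z_def using continuous_closed_preimage_constant[OF \<sigma>(1)] by simp
    then have "compact Z"
      unfolding compact_eq_bounded_closed Z_def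
      by (auto intro: bounded_subset[OF bounded_closed_interval[of u v]])
    then obtain z where z: "z \<in> Z" "\<And>t. t \<in> Z \<Longrightarrow> t \<le> z"
      using compact_attains_sup[OF _ nonempty] by blast
    have "transit c a (\<sigma> v) - transit c a (\<sigma> z) \<le> v - z"
    proof (rule step)
      show "u \<le> z" "z \<le> v" using z(1) by (auto simp: Z_def)
      show "\<sigma> t \<noteq> a" if "z < t" "t \<le> v" for t
        using z(1) z(2)[of t] that by (auto simp: Z_def)
    qed
    moreover have "\<sigma> z = a" "u \<le> z" using z by (auto simp: Z_def)
    moreover have "transit c a (\<sigma> u) \<ge> 0" using transit_nonneg[OF c a \<sigma>(2)[of u]] uv by simp
    ultimately show ?thesis using transit_a[OF c a] by simp
  qed
qed

section \<open>The Euler-Lagrange equation along extremals\<close>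

text \<open>The Euler-Lagrange equation with \<open>\<rho>'' = 1 / speed\<close>, cleared of
  denominators. With \<open>A = S^2 w^2\<close> and \<open>B = c p^2\<close> the quadratic for
  \<open>S\<close> gives \<open>A - B = a w^3 S\<close>, and \<open>2 S - a w = R\<close> gives
  \<open>A + B = S w^2 R\<close>; these two products eliminate \<open>a\<close> and the square root
  \<open>R\<close> of the discriminant from \<open>speed\<close>.\<close>

lemma speed_identity:
  defines "s \<equiv> \<lambda>p. ht c a p"
  shows "speed c a p * (1 + p\<^sup>2) * (c * p\<^sup>2 + (s p)\<^sup>2 * (1 + p\<^sup>2))
    = s p * ((s p)\<^sup>2 * (1 + p\<^sup>2) + c * (2 - p\<^sup>2))"
proof -
  define w S R A B where "w = sqrt (1 + p\<^sup>2)" and "S = ht c a p" and "R = sqrt (discr c a p)"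
    and "A = S\<^sup>2 * w\<^sup>2" and "B = c * p\<^sup>2"
  have w: "w > 0" "w\<^sup>2 = 1 + p\<^sup>2" using sqrt_facts[of p] by (auto simp: w_def)
  have S: "S > 0" "2 * S = a * w + R" using ht_pos[OF c a] by (auto simp: S_def ht_def R_def w_def)
  have "S\<^sup>2 = a * w * S + B / w\<^sup>2"
    using ht_quadratic[OF c a, of p] by (simp add: S_def w_def B_def)
  then have "A = (a * w * S + B / w\<^sup>2) * w\<^sup>2" by (simp add: A_def)
  also have "\<dots> = a * w * S * w\<^sup>2 + B" using w(1) by (simp add: distrib_right)
  finally have AmB: "A - B = a * w ^ 3 * S"
    by (simp add: power2_eq_square power3_eq_cube)
  have "A + B = 2 * A - a * w ^ 3 * S" using AmB by simp
  also have "\<dots> = S * w\<^sup>2 * (2 * S - a * w)"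
    by (simp add: A_def algebra_simps power2_eq_square power3_eq_cube)
  also have "2 * S - a * w = R" using S(2) by simp
  finally have ApB: "A + B = S * w\<^sup>2 * R" .
  have R: "R > 0" using discr_pos[OF c a, of p] by (simp add: R_def)
  have K: "2 * speed c a p = a / w + (a\<^sup>2 + 4 * c / (w\<^sup>2)\<^sup>2) / R"
    by (simp add: speed_def w_def R_def mult.commute)
  have "2 * speed c a p * (S * w ^ 4 * (S * w\<^sup>2 * R))
      = (a * w ^ 3 * S) * (S * w\<^sup>2 * R) + (a * w ^ 3 * S)\<^sup>2 + 4 * c * (S\<^sup>2 * w\<^sup>2)"
    unfolding K using w(1) R by (simp add: field_simps power2_eq_square power3_eq_cube power4_eq_xxxx)
  also have "\<dots> = (A - B) * (A + B) + (A - B)\<^sup>2 + 4 * c * A"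
    unfolding AmB ApB by (simp add: A_def)
  also have "\<dots> = 2 * A * (A - B + 2 * c)"
    by (simp add: algebra_simps power2_eq_square)
  also have "\<dots> = 2 * (S * w\<^sup>2) * (S * (A - B + 2 * c))"
    by (simp add: A_def power2_eq_square)
  finally have "(2 * (S * w\<^sup>2)) * (speed c a p * w\<^sup>2 * (A + B)) = (2 * (S * w\<^sup>2)) * (S * (A - B + 2 * c))"
    unfolding ApB by (simp add: power2_eq_square power4_eq_xxxx mult_ac)
  then have "speed c a p * w\<^sup>2 * (A + B) = S * (A - B + 2 * c)"
    using S(1) w(1) by simp
  moreover have "A - B + 2 * c = S\<^sup>2 * w\<^sup>2 + c * (2 - p\<^sup>2)"
    by (simp add: A_def B_def algebra_simps)
  ultimately have "speed c a p * w\<^sup>2 * (B + A) = S * (S\<^sup>2 * w\<^sup>2 + c * (2 - p\<^sup>2))"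
    by (simp only: add.commute)
  then show ?thesis unfolding A_def B_def w(2) S_def s_def .
qed

lemma euler_lagrange_identity:
  defines "s \<equiv> \<lambda>p. ht c a p"
  shows "(1 + p\<^sup>2) * ((c + (s p)\<^sup>2) * p\<^sup>2 + (s p)\<^sup>2)
    = s p * (1 / speed c a p) * ((s p)\<^sup>2 * p\<^sup>2 + c * (2 - p\<^sup>2) + (s p)\<^sup>2)"
proof -
  have e1: "(c + (s p)\<^sup>2) * p\<^sup>2 + (s p)\<^sup>2 = c * p\<^sup>2 + (s p)\<^sup>2 * (1 + p\<^sup>2)"
    by (simp add: algebra_simps)
  have e2: "(s p)\<^sup>2 * p\<^sup>2 + c * (2 - p\<^sup>2) + (s p)\<^sup>2 = (s p)\<^sup>2 * (1 + p\<^sup>2) + c * (2 - p\<^sup>2)"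
    by (simp add: algebra_simps)
  have "(1 + p\<^sup>2) * (c * p\<^sup>2 + (s p)\<^sup>2 * (1 + p\<^sup>2))
      = s p * ((s p)\<^sup>2 * (1 + p\<^sup>2) + c * (2 - p\<^sup>2)) / speed c a p"
    using speed_identity[of p, folded s_def] speed_pos[OF c a, of p]
    by (simp add: nonzero_eq_divide_eq mult_ac)
  then show ?thesis unfolding e1 e2 by simp
qed

lemma first_integral_powr:
  "c * p\<^sup>2 / (ht c a p * (1 + p\<^sup>2) powr (3/2)) - ht c a p / sqrt (1 + p\<^sup>2) = - a"
proof -
  have "(1 + p\<^sup>2) powr (3/2) = ((1 + p\<^sup>2) powr (1/2)) powr 3"
    by (simp add: powr_powr)
  also have "\<dots> = sqrt (1 + p\<^sup>2) ^ 3"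
    using sqrt_facts[of p] by (simp add: powr_half_sqrt powr_numeral)
  finally show ?thesis
    using first_int_ht[OF c a, of p] by (simp add: first_int_def)
qed

section \<open>The extremal that fits into \<open>[-h, h]\<close>\<close>

context
  fixes h r :: real
  assumes h: "h > 0" and ar: "a < r" and T: "transit c a r = h"
begin

lemma in_range: "x \<in> {-h..h} \<Longrightarrow> \<bar>x\<bar> \<le> pos c a (slope c a r)"
  using T by (auto simp: transit_def)

lemma slope_r: "slope c a r \<ge> 0"
  using slope_nonneg[OF c a] ar by simp

lemma pos_inv_h: "pos_inv c a h = slope c a r"
  using pos_inv_pos[of "slope c a r"] T by (simp add: transit_def)

lemma pos_inv_0 [simp]: "pos_inv c a 0 = 0"
  using pos_inv_pos[of 0] pos_0[OF c a] by simp

lemma extremal_0 [simp]: "extremal c a 0 = a"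
  by (simp add: extremal_def ht_0[OF c a])

lemma extremal_even: "x \<in> {-h..h} \<Longrightarrow> extremal c a (- x) = extremal c a x"
  using pos_inv_minus[OF in_range slope_r] by (simp add: extremal_def ht_minus[OF c a])

lemma extremal_h: "extremal c a h = r" "extremal c a (- h) = r"
  using extremal_even[of h] h ht_slope[OF c a, of r] ar pos_inv_h by (simp_all add: extremal_def)

lemma extremal_ge: "a \<le> extremal c a x"
  by (simp add: extremal_def ht_ge_a[OF c a])

lemma pos_inv_strict_mono:
  "x \<in> {-h..h} \<Longrightarrow> y \<in> {-h..h} \<Longrightarrow> x < y \<Longrightarrow> pos_inv c a x < pos_inv c a y"
  using pos_inv_less[OF in_range in_range slope_r] by blast

lemma transit_extremal: "x \<in> {-h..h} \<Longrightarrow> transit c a (extremal c a x) = \<bar>x\<bar>"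
proof -
  have *: "transit c a (extremal c a x) = x" if x: "x \<in> {0..h}" for x
  proof -
    have xh: "x \<in> {-h..h}" using x h by auto
    have "pos_inv c a x \<ge> 0"
      using pos_inv_strict_mono[of 0 x] xh h x by (cases "x = 0") auto
    then show ?thesis
      using slope_ht[OF c a, of "pos_inv c a x"] pos_pos_inv[OF in_range[OF xh] slope_r]
      by (simp add: transit_def extremal_def)
  qed
  assume "x \<in> {-h..h}"
  then show ?thesis
    using *[of "\<bar>x\<bar>"] extremal_even[of x] by (cases "x \<ge> 0") auto
qed

lemma extremal_strictly_convex: "strictly_convex_on {-h..h} (extremal c a)"
  unfolding strictly_convex_on_def
proof (intro ballI allI impI)
  have *: "extremal c a (t * x + (1 - t) * y) < t * extremal c a x + (1 - t) * extremal c a y"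
    if x: "x \<in> {-h..h}" and y: "y \<in> {-h..h}" and t: "0 < t" "t < 1" and xy: "x < y" for x y t
  proof -
    define z where "z = t * x + (1 - t) * y"
    have zx: "z - x = (1 - t) * (y - x)" and yz: "y - z = t * (y - x)"
      by (simp_all add: z_def algebra_simps)
    have "z - x > 0" "y - z > 0" unfolding zx yz using t xy by simp_all
    then have z: "x < z" "z < y" by simp_all
    have der: "(extremal c a has_real_derivative pos_inv c a u) (at u)" if "u \<in> {-h..h}" for u
      by (rule extremal_has_derivative[OF in_range[OF that] slope_r])
    obtain u where u: "x < u" "u < z" "extremal c a z - extremal c a x = (z - x) * pos_inv c a u"
      using MVT2[OF z(1), of "extremal c a" "pos_inv c a"] der x y z by auto
    obtain v where v: "z < v" "v < y" "extremal c a y - extremal c a z = (y - z) * pos_inv c a v"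
      using MVT2[OF z(2), of "extremal c a" "pos_inv c a"] der x y z by auto
    have "pos_inv c a u < pos_inv c a v"
      using pos_inv_strict_mono[of u v] u v x y by auto
    then have "t * (1 - t) * (y - x) * pos_inv c a u < t * (1 - t) * (y - x) * pos_inv c a v"
      using t xy by (intro mult_strict_left_mono mult_pos_pos) auto
    then have "t * (extremal c a z - extremal c a x) < (1 - t) * (extremal c a y - extremal c a z)"
      unfolding u(3) v(3) zx yz by (simp add: mult_ac)
    then show ?thesis unfolding z_def[symmetric] by (simp add: algebra_simps)
  qed
  fix x y t :: real assume "x \<in> {-h..h}" "y \<in> {-h..h}" "x \<noteq> y \<and> 0 < t \<and> t < 1"
  then show "extremal c a (t * x + (1 - t) * y) < t * extremal c a x + (1 - t) * extremal c a y"
    using *[of x y t] *[of y x "1 - t"] by (cases "x < y") (auto simp: add.commute)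
qed

lemma extremal_W11_deriv: "W11_deriv h (extremal c a) (pos_inv c a)"
  unfolding W11_deriv_def
proof (intro conjI ballI)
  have "continuous_on {-h..h} (pos_inv c a)"
    by (rule DERIV_continuous_on) (rule has_field_derivative_at_within[OF pos_inv_has_derivative[OF in_range slope_r]])
  then show "pos_inv c a absolutely_integrable_on {-h..h}"
    by (rule absolutely_integrable_continuous_real)
  fix x assume x: "x \<in> {-h..h}"
  have "(pos_inv c a has_integral extremal c a x - extremal c a (- h)) {-h..x}"
  proof (rule fundamental_theorem_of_calculus)
    fix y assume "y \<in> {-h..x}"
    then have "y \<in> {-h..h}" using x by auto
    then show "(extremal c a has_vector_derivative pos_inv c a y) (at y within {-h..x})"
      using extremal_has_derivative[OF in_range slope_r, of y]
      by (auto simp: has_real_derivative_iff_has_vector_derivative[symmetric]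
          intro: has_field_derivative_at_within)
  qed (use x in auto)
  then show "extremal c a x = extremal c a (- h) + integral {-h..x} (pos_inv c a)"
    by (simp add: integral_unique)
qed

lemma extremal_in_Xset: "extremal c a \<in> Xset h r"
  unfolding Xset_def W11_def using extremal_W11_deriv extremal_h extremal_ge a
  by (auto intro: less_le_trans)

lemma extremal_slope:
  assumes x: "x \<in> {-h..h}"
  shows "(if x < 0 then - 1 else 1) * pos_inv c a x = slope c a (extremal c a x)"
proof (cases "x < 0")
  case True
  then have "pos_inv c a x < 0" using pos_inv_strict_mono[of x 0] x h by simp
  then show ?thesis
    using True slope_ht[OF c a, of "- pos_inv c a x"] by (simp add: extremal_def ht_minus[OF c a])
next
  case False
  then have "pos_inv c a x \<ge> 0" using pos_inv_strict_mono[of 0 x] x h by (cases "x = 0") auto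
  then show ?thesis using False slope_ht[OF c a] by (simp add: extremal_def)
qed

lemma Energy_extremal: "Energy h c (extremal c a) = val h r c a"
proof (rule energy_ge_val(2)[OF extremal_in_Xset c h _ extremal_ge extremal_0, THEN iffD2])
  show "(0::real) \<in> {-h..h}" using h by simp
  have "negligible {x \<in> {-h..h}. wderiv h (extremal c a) x \<noteq> pos_inv c a x}"
    by (rule W11_deriv_unique[OF W11_deriv_wderiv[OF extremal_in_Xset] extremal_W11_deriv])
  then show "negligible {x \<in> {-h..h}.
      (if x < 0 then - 1 else 1) * wderiv h (extremal c a) x \<noteq> slope c a (extremal c a x)}"
    by (rule negligible_subset) (auto simp: extremal_slope[symmetric] split: if_splits)
qed

end

end

section \<open>Minimizers\<close>

text \<open>Keeps minimizing heights away from \<open>0\<close>. For \<open>c = 0\<close> this is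
  the comparison with catenaries \<open>b = r / cosh t\<close>, \<open>t \<ge> \<tau>\<close>;
  submodularity says that raising the height from \<open>b\<close> to \<open>Pi0 h r\<close> changes
  \<open>val\<close> for \<open>c\<close> by no more than for \<open>0\<close>.\<close>

lemma val_below_Pi0:
  fixes h r :: real
  assumes hyp: "h > 0" "r > 0" "h / r \<le> omega" and c: "c \<ge> 0" and b: "0 < b" "b < Pi0 h r"
  shows "val h r c (Pi0 h r) \<le> val h r c b"
proof -
  obtain \<tau> where \<tau>: "0 < \<tau>" "2 * \<tau> \<le> 1 + exp (- 2 * \<tau>)" "h = r * (\<tau> / cosh \<tau>)"
    "Pi0 h r = r / cosh \<tau>"
    using Pi0_form[OF hyp] by metis
  have ch: "cosh \<tau> \<ge> 1" by (rule cosh_real_ge_1)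
  have br: "b < r / cosh \<tau>" using b \<tau> by simp
  then have lt: "cosh \<tau> < r / b" using b ch by (simp add: field_simps)
  define t where "t = arcosh (r / b)"
  have t: "cosh t = r / b" "0 \<le> t" using lt ch by (auto simp: t_def cosh_arcosh_real arcosh_nonneg_real)
  then have "\<tau> \<le> t" using lt \<tau>(1) cosh_real_nonneg_less_iff[of \<tau> t] by simp
  then have "val h r 0 (r / cosh \<tau>) \<le> val h r 0 (r / cosh t)"
    by (rule val_catenary_minimal[OF hyp(2) \<tau>(1,2) _ \<tau>(3)])
  moreover have "r / cosh t = b" using t(1) hyp(2) by simp
  ultimately have "val h r 0 (Pi0 h r) \<le> val h r 0 b" using \<tau>(4) by simp
  moreover have "Pi0 h r \<le> r"
    using \<tau>(4) ch hyp(2) by (simp add: divide_le_eq mult_le_cancel_left1)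
  ultimately show ?thesis
    using val_submodular[of c b "Pi0 h r" r h] c b by simp
qed

lemma val_minimum_exists:
  fixes h r :: real
  assumes hyp: "h > 0" "r > 0" "h / r \<le> omega" and c: "c \<ge> 0"
  obtains a where "0 < a" "a \<le> r" "\<And>b. 0 < b \<Longrightarrow> b \<le> r \<Longrightarrow> val h r c a \<le> val h r c b"
proof -
  obtain \<tau> where \<tau>: "Pi0 h r = r / cosh \<tau>"
    using Pi0_form[OF hyp] by metis
  then have P: "0 < Pi0 h r" "Pi0 h r \<le> r"
    using hyp(2) cosh_real_ge_1[of \<tau>] by (simp_all add: divide_le_eq mult_le_cancel_left1)
  have "\<exists>a\<in>{Pi0 h r..r}. \<forall>b\<in>{Pi0 h r..r}. val h r c a \<le> val h r c b"
    by (rule continuous_attains_inf[OF compact_Icc _ continuous_on_val]) (use P c hyp in auto)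
  then obtain a where a: "a \<in> {Pi0 h r..r}" "\<And>b. b \<in> {Pi0 h r..r} \<Longrightarrow> val h r c a \<le> val h r c b"
    by blast
  have "val h r c a \<le> val h r c b" if b: "0 < b" "b \<le> r" for b
  proof (cases "b < Pi0 h r")
    case True
    then show ?thesis
      using val_below_Pi0[OF hyp c b(1) True] a(2)[of "Pi0 h r"] P by simp
  next
    case False
    then show ?thesis using a(2)[of b] b by simp
  qed
  then show ?thesis using that[of a] a P by auto
qed

lemma transit_Pi0:
  fixes h r :: real
  assumes hyp: "h > 0" "r > 0" "h / r \<le> omega"
  shows "transit 0 (Pi0 h r) r = h" and "0 < Pi0 h r" and "Pi0 h r < r"
proof -
  obtain \<tau> where \<tau>: "0 < \<tau>" "h = r * (\<tau> / cosh \<tau>)" "Pi0 h r = r / cosh \<tau>"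
    using Pi0_form[OF hyp] by metis
  have ch: "cosh \<tau> > 1" using \<tau>(1) cosh_real_nonneg_less_iff[of 0 \<tau>] by simp
  show P: "0 < Pi0 h r" using \<tau>(3) hyp(2) by simp
  show "Pi0 h r < r" using \<tau>(3) hyp(2) ch by (simp add: divide_less_eq)
  have "r = Pi0 h r * cosh \<tau>" using \<tau>(3) by simp
  then have "transit 0 (Pi0 h r) r = Pi0 h r * \<tau>"
    using transit_catenary[OF P, of \<tau>] \<tau>(1) by simp
  then show "transit 0 (Pi0 h r) r = h" using \<tau> by simp
qed

text \<open>A minimum at or below \<open>Pi0 h r\<close> would make \<open>Pi0 h r\<close> a minimum
  too, and its extremal would have half-width \<open>h\<close>. But the catenary of that height
  already has half-width \<open>h\<close>, and for \<open>c > 0\<close> the extremal is strictly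
  wider.\<close>

lemma val_minimizer_gt_Pi0:
  fixes h r :: real
  assumes hyp: "h > 0" "r > 0" "h / r \<le> omega" and c: "c > 0" and a: "0 < a" "a \<le> r"
    and min: "\<And>b. 0 < b \<Longrightarrow> b \<le> r \<Longrightarrow> val h r c a \<le> val h r c b"
  shows "Pi0 h r < a"
proof (rule ccontr)
  assume n: "\<not> Pi0 h r < a"
  note P = transit_Pi0[OF hyp]
  have "val h r c (Pi0 h r) \<le> val h r c a"
    using val_below_Pi0[OF hyp _ a(1)] c n by (cases "a = Pi0 h r") auto
  then have "transit c (Pi0 h r) r = h"
    using P c hyp(1) min by (intro transit_eq_of_val_minimal(1)) (auto intro: order_trans)
  moreover have "transit 0 (Pi0 h r) r < transit c (Pi0 h r) r"
    using transit_less_catenary[of c "Pi0 h r" "Pi0 h r" "Pi0 h r" r] P c by simp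
  ultimately show False using P(1) by simp
qed

lemma extremal_is_minimizer:
  assumes c: "c \<ge> 0" and a: "0 < a" "a \<le> r" and h: "h > 0"
    and min: "\<And>b. 0 < b \<Longrightarrow> b \<le> r \<Longrightarrow> val h r c a \<le> val h r c b"
  shows "is_minimizer h r c (extremal c a)"
  unfolding is_minimizer_def
proof (intro conjI ballI)
  note T = transit_eq_of_val_minimal[OF assms]
  show "extremal c a \<in> Xset h r" by (rule extremal_in_Xset[OF c a(1) h T(2,1)])
  fix \<sigma> assume \<sigma>: "\<sigma> \<in> Xset h r"
  have "continuous_on {-h..h} \<sigma>" by (rule W11_continuous[OF W11_deriv_wderiv[OF \<sigma>]])
  then obtain x0 where x0: "x0 \<in> {-h..h}" "\<And>x. x \<in> {-h..h} \<Longrightarrow> \<sigma> x0 \<le> \<sigma> x"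
    using continuous_attains_inf[of "{-h..h}" \<sigma>] h by auto
  have "\<sigma> x0 > 0" "\<sigma> h = r" using \<sigma> x0 by (auto simp: Xset_def)
  then have "val h r c a \<le> val h r c (\<sigma> x0)" using min[of "\<sigma> x0"] x0(2)[of h] h by simp
  also have "\<dots> \<le> Energy h c \<sigma>" by (rule energy_ge_val(1)[OF \<sigma> c h x0 refl])
  finally show "Energy h c (extremal c a) \<le> Energy h c \<sigma>"
    using Energy_extremal[OF c a(1) h T(2,1)] by simp
qed

lemma minimizer_eq_extremal:
  fixes h r :: real
  assumes hyp: "h > 0" "r > 0" "h / r \<le> omega" and c: "c \<ge> 0" and m: "is_minimizer h r c \<sigma>"
  obtains a where "0 < a" "a < r" "transit c a r = h"
    "\<And>b. 0 < b \<Longrightarrow> b \<le> r \<Longrightarrow> val h r c a \<le> val h r c b"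
    "\<And>x. x \<in> {-h..h} \<Longrightarrow> \<sigma> x = extremal c a x"
proof -
  have \<sigma>: "\<sigma> \<in> Xset h r" and le: "\<And>\<rho>. \<rho> \<in> Xset h r \<Longrightarrow> Energy h c \<sigma> \<le> Energy h c \<rho>"
    using m by (auto simp: is_minimizer_def)
  define g where "g = wderiv h \<sigma>"
  note W = W11_deriv_wderiv[OF \<sigma>, folded g_def]
  note cont = W11_continuous[OF W]
  have bd: "\<sigma> (- h) = r" "\<sigma> h = r" using \<sigma> by (auto simp: Xset_def)
  obtain x0 where x0: "x0 \<in> {-h..h}" "\<And>x. x \<in> {-h..h} \<Longrightarrow> \<sigma> x0 \<le> \<sigma> x"
    using continuous_attains_inf[OF _ _ cont] hyp(1) by auto
  define a where "a = \<sigma> x0"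
  note x0 = x0[folded a_def]
  have a: "0 < a" "a \<le> r" using \<sigma> x0 bd hyp(1) x0(2)[of h] by (auto simp: Xset_def a_def)
  note ge = energy_ge_val[OF \<sigma> c hyp(1) x0 a_def[symmetric]]
  obtain b where b: "0 < b" "b \<le> r" "\<And>b'. 0 < b' \<Longrightarrow> b' \<le> r \<Longrightarrow> val h r c b \<le> val h r c b'"
    using val_minimum_exists[OF hyp c] by metis
  note Tb = transit_eq_of_val_minimal[OF c b(1,2) hyp(1) b(3)]
  have "Energy h c \<sigma> \<le> val h r c b"
    using le[OF extremal_in_Xset[OF c b(1) hyp(1) Tb(2,1)]] Energy_extremal[OF c b(1) hyp(1) Tb(2,1)] by simp
  then have ab: "val h r c a \<le> val h r c b" and E: "Energy h c \<sigma> = val h r c a"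
    using ge(1) b(3)[OF a] by simp_all
  have min: "val h r c a \<le> val h r c b'" if "0 < b'" "b' \<le> r" for b'
    using ab b(3)[OF that] by simp
  note T = transit_eq_of_val_minimal[OF c a hyp(1) min]
  have N: "negligible {x \<in> {-h..h}. (if x < x0 then - 1 else 1) * g x \<noteq> slope c a (\<sigma> x)}"
    using ge(2) E by (simp add: g_def)
  have slc: "continuous_on {-h..h} (\<lambda>t. slope c a (\<sigma> t))"
    by (rule continuous_on_compose2[OF continuous_on_slope[OF c a(1)] cont]) (use x0(2) in auto)
  \<comment> \<open>The equality case holds almost everywhere. Integrated, it exhibits
    \<open>\<sigma>\<close> on each side of \<open>x0\<close> as a primitive of a continuous
    function, so \<open>\<sigma>\<close> is classically differentiable there.\<close>
  have inc: "\<sigma> v - \<sigma> u = e * integral {u..v} (\<lambda>t. slope c a (\<sigma> t))"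
    if uv: "-h \<le> u" "u \<le> v" "v \<le> h" and e: "e = 1 \<and> x0 \<le> u \<or> e = - 1 \<and> v \<le> x0" for u v e
  proof -
    have "integral {u..v} g = integral {u..v} (\<lambda>t. e * slope c a (\<sigma> t))"
    proof (rule integral_spike)
      show "negligible ({x \<in> {-h..h}. (if x < x0 then - 1 else 1) * g x \<noteq> slope c a (\<sigma> x)} \<union> {x0})"
        using N by simp
      fix t assume t: "t \<in> {u..v} - ({x \<in> {-h..h}. (if x < x0 then - 1 else 1) * g x \<noteq> slope c a (\<sigma> x)} \<union> {x0})"
      then have *: "(if t < x0 then - 1 else 1) * g t = slope c a (\<sigma> t)" "t \<noteq> x0" using uv by auto
      show "e * slope c a (\<sigma> t) = g t"
        unfolding *(1)[symmetric] using e t *(2) by auto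
    qed
    then show ?thesis using W11_increment[OF W uv] by simp
  qed
  have der: "(\<sigma> has_real_derivative e * slope c a (\<sigma> t)) (at t)"
    if uv: "-h \<le> u" "v \<le> h" "t \<in> {u<..<v}" and e: "e = 1 \<and> x0 \<le> u \<or> e = - 1 \<and> v \<le> x0" for u v t e
  proof -
    have "((\<lambda>y. \<sigma> u + e * integral {u..y} (\<lambda>t. slope c a (\<sigma> t))) has_real_derivative
        0 + e * slope c a (\<sigma> t)) (at t within {u..v})"
      using uv
      by (intro DERIV_add DERIV_const DERIV_cmult integral_has_real_derivative
          continuous_on_subset[OF slc]) auto
    then have "((\<lambda>y. \<sigma> u + e * integral {u..y} (\<lambda>t. slope c a (\<sigma> t))) has_real_derivative
        e * slope c a (\<sigma> t)) (at t)"
      using uv by (simp add: at_within_Icc_at)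
    then show ?thesis
    proof (rule has_field_derivative_transform_within_open[where S = "{u<..<v}"])
      fix y assume y: "y \<in> {u<..<v}"
      then have "\<sigma> y - \<sigma> u = e * integral {u..y} (\<lambda>t. slope c a (\<sigma> t))"
        using uv e by (intro inc) auto
      then show "\<sigma> u + e * integral {u..y} (\<lambda>t. slope c a (\<sigma> t)) = \<sigma> y" by simp
    qed (use uv in auto)
  qed
  have R: "transit c a (\<sigma> v) - transit c a (\<sigma> u) \<le> v - u" if uv: "x0 \<le> u" "u \<le> v" "v \<le> h" for u v
  proof (rule transit_increment_le[OF c a(1) uv(2)])
    show "continuous_on {u..v} \<sigma>" by (rule continuous_on_subset[OF cont]) (use uv x0 in auto)
    show "a \<le> \<sigma> t" if "t \<in> {u..v}" for t using x0(2)[of t] that uv x0(1) by auto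
    show "(\<sigma> has_real_derivative slope c a (\<sigma> t)) (at t)" if "t \<in> {u<..<v}" for t
      using der[of u v t 1] that uv x0(1) by auto
  qed
  \<comment> \<open>Reflected, the left leg solves the same equation as the right one.\<close>
  have L: "transit c a (\<sigma> (- v)) - transit c a (\<sigma> (- u)) \<le> v - u" if uv: "- x0 \<le> u" "u \<le> v" "v \<le> h" for u v
  proof (rule transit_increment_le[OF c a(1) uv(2)])
    have "continuous_on {-v..-u} \<sigma>" by (rule continuous_on_subset[OF cont]) (use uv x0 in auto)
    then show "continuous_on {u..v} (\<lambda>t. \<sigma> (- t))"
      by (rule continuous_on_compose2) (auto intro: continuous_intros)
    show "a \<le> \<sigma> (- t)" if "t \<in> {u..v}" for t using x0(2)[of "- t"] that uv x0(1) by auto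
    show "((\<lambda>t. \<sigma> (- t)) has_real_derivative slope c a (\<sigma> (- t))) (at t)" if "t \<in> {u<..<v}" for t
    proof -
      have "(\<sigma> has_real_derivative (- 1) * slope c a (\<sigma> (- t))) (at (- t))"
        using der[of "- v" "- u" "- t" "- 1"] that uv x0(1) by auto
      then have "((\<lambda>t. \<sigma> (- t)) has_real_derivative ((- 1) * slope c a (\<sigma> (- t))) * (- 1)) (at t)"
        by (rule DERIV_chain2) (auto intro!: derivative_eq_intros)
      then show ?thesis by simp
    qed
  qed
  have ta: "transit c a (\<sigma> x0) = 0" using transit_a[OF c a(1)] by (simp add: a_def)
  \<comment> \<open>Each leg climbs from \<open>a\<close> to \<open>r\<close>, which takes an
    abscissa of at least \<open>transit c a r = h\<close>; both legs share an interval of length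
    \<open>2 h\<close>.\<close>
  have "h \<le> h - x0" using R[of x0 h] x0(1) ta T(1) bd by simp
  moreover have "h \<le> h + x0" using L[of "- x0" h] x0(1) ta T(1) bd by simp
  ultimately have z: "x0 = 0" by simp
  \<comment> \<open>The inequality holds on both parts of the leg, before and after
    \<open>x\<close>, and its sum over the whole leg is an equality. So both are equalities and
    there is no room for resting at height \<open>a\<close>.\<close>
  have "transit c a (\<sigma> x) = \<bar>x\<bar>" if x: "x \<in> {-h..h}" for x
  proof (cases "x \<ge> 0")
    case True
    then show ?thesis using R[of 0 x] R[of x h] x ta T(1) bd z by simp
  next
    case False
    then show ?thesis using L[of 0 "- x"] L[of "- x" h] x ta T(1) bd z by simp
  qed
  then have tr: "transit c a (\<sigma> x) = transit c a (extremal c a x)" if "x \<in> {-h..h}" for x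
    using transit_extremal[OF c a(1) hyp(1) T(2,1) that] that by simp
  have "\<sigma> x = extremal c a x" if x: "x \<in> {-h..h}" for x
  proof -
    have ge: "a \<le> \<sigma> x" "a \<le> extremal c a x"
      using x0(2)[OF x] extremal_ge[OF c a(1) hyp(1) T(2,1)] by auto
    then show ?thesis
      using tr[OF x] transit_less_iff[OF c a(1) ge] transit_less_iff[OF c a(1) ge(2,1)] by simp
  qed
  then show ?thesis using that[OF a(1) T(2,1) min] by blast
qed

section \<open>Bounds for minimizers and the limit of large \<open>c\<close>\<close>

lemma extremal_less:
  assumes c: "c \<ge> 0" and a: "0 < a" "a < r" and h: "h > 0" and T: "transit c a r = h"
    and x: "x \<in> {-h<..<h}"
  shows "extremal c a x < r"
proof -
  have "transit c a (extremal c a x) < transit c a r"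
    using transit_extremal[OF c a(1) h a(2) T, of x] x T by auto
  then show ?thesis
    using transit_less_iff[OF c a(1), of "extremal c a x" r] extremal_ge[OF c a(1) h a(2) T] a by simp
qed

text \<open>Both curves reach \<open>r\<close> at \<open>|x| = h\<close>. Between the height
  \<open>s\<close> of the catenary at \<open>x\<close> and \<open>r\<close>, the extremal needs more
  abscissa, so it has passed \<open>s\<close> closer to the centre and is higher at
  \<open>x\<close>.\<close>

lemma catenary_less_extremal:
  assumes c: "c > 0" and a: "0 < a" "a < r" and h: "h > 0" and T: "transit c a r = h"
    and P: "0 < Pi0 h r" "Pi0 h r < a" "transit 0 (Pi0 h r) r = h" and x: "x \<in> {-h<..<h}"
  shows "rho0 h r x < extremal c a x"
proof -
  define s where "s = rho0 h r x"
  have c0: "c \<ge> 0" using c by simp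
  have s: "s = Pi0 h r * cosh (\<bar>x\<bar> / Pi0 h r)"
  proof -
    have "\<bar>x\<bar> / Pi0 h r = \<bar>x / Pi0 h r\<bar>" using P(1) by simp
    then show ?thesis by (simp only: s_def rho0_def cosh_real_abs)
  qed
  have Ps: "Pi0 h r \<le> s" using P cosh_real_ge_1[of "\<bar>x\<bar> / Pi0 h r"] by (simp add: s)
  have ts: "transit 0 (Pi0 h r) s = \<bar>x\<bar>"
    using transit_catenary[OF P(1), of "\<bar>x\<bar> / Pi0 h r"] P by (simp add: s)
  have te: "transit c a (extremal c a x) = \<bar>x\<bar>"
    using transit_extremal[OF c0 a(1) h a(2) T, of x] x by simp
  have ge: "a \<le> extremal c a x" by (rule extremal_ge[OF c0 a(1) h a(2) T])
  have "transit 0 (Pi0 h r) s < transit 0 (Pi0 h r) r" using ts P(3) x by auto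
  then have sr: "s < r" using transit_less_iff[OF _ P(1) Ps, of 0 r] P a by simp
  have "s < extremal c a x"
  proof (cases "a \<le> s")
    case True
    have "transit c a s < transit c a (extremal c a x)"
      using transit_less_catenary[OF c P(1) less_imp_le[OF P(2)] True sr] ts te T P(3) by simp
    then show ?thesis using transit_less_iff[OF c0 a(1) True ge] by simp
  next
    case False
    then show ?thesis using ge by simp
  qed
  then show ?thesis by (simp add: s_def)
qed

text \<open>By the first integral the slopes of a minimizer are of order \<open>1 / sqrt c\<close>.\<close>

lemma extremal_near_r:
  assumes c: "c > r\<^sup>2" and a: "0 < a" "a < r" and h: "h > 0" and T: "transit c a r = h"
    and x: "x \<in> {-h..h}"
  shows "\<bar>extremal c a x - r\<bar> \<le> 2 * h * (r / sqrt (c - r\<^sup>2))"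
proof -
  have r: "r > 0" using a by simp
  then have c0: "c \<ge> 0" using c by (meson less_imp_le order_trans zero_le_power2)
  note E = c0 a(1) h a(2) T
  have bound: "\<bar>pos_inv c a y\<bar> \<le> r / sqrt (c - r\<^sup>2)" if y: "y \<in> {-h<..<h}" for y
  proof -
    define p s w where "p = pos_inv c a y" and "s = ht c a p" and "w = sqrt (1 + p\<^sup>2)"
    have s: "s > 0" "s < r" using ht_pos[OF c0 a(1)] extremal_less[OF c0 a h T y]
      by (auto simp: s_def p_def extremal_def)
    have w: "w > 0" "w\<^sup>2 = 1 + p\<^sup>2" using sqrt_facts[of p] by (auto simp: w_def)
    have "c * p\<^sup>2 / (s * w ^ 3) < s / w"
      using first_int_ht[OF c0 a(1), of p] a by (simp add: first_int_def s_def w_def)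
    then have "c * p\<^sup>2 / (s * w ^ 3) * (s * w ^ 3) < s / w * (s * w ^ 3)"
      using s w by (intro mult_strict_right_mono) auto
    then have "c * p\<^sup>2 < s\<^sup>2 * w\<^sup>2"
      using s w(1) by (simp add: power2_eq_square power3_eq_cube)
    also have "s\<^sup>2 * w\<^sup>2 \<le> r\<^sup>2 * w\<^sup>2" using s by (intro mult_right_mono power_mono) auto
    finally have "p\<^sup>2 * (c - r\<^sup>2) \<le> r\<^sup>2" unfolding w(2) by (simp add: algebra_simps)
    then have "sqrt (p\<^sup>2) \<le> sqrt (r\<^sup>2 / (c - r\<^sup>2))"
      using c by (intro real_sqrt_le_mono) (simp add: pos_le_divide_eq)
    then show ?thesis using r by (simp add: p_def real_sqrt_divide)
  qed
  have rh: "extremal c a h = r" by (rule extremal_h(1)[OF E])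
  show ?thesis
  proof (cases "x = h")
    case True
    then show ?thesis using rh h r c by simp
  next
    case False
    then have xh: "x < h" using x by simp
    have "(extremal c a has_real_derivative pos_inv c a y) (at y)" if "y \<in> {-h..h}" for y
      by (rule extremal_has_derivative[OF c0 a(1) in_range[OF E that] slope_r[OF E]])
    then obtain y where y: "x < y" "y < h" "extremal c a h - extremal c a x = (h - x) * pos_inv c a y"
      using MVT2[OF xh, of "extremal c a" "pos_inv c a"] x by auto
    have "\<bar>extremal c a x - r\<bar> = (h - x) * \<bar>pos_inv c a y\<bar>"
      using y(3) rh xh by (simp add: abs_mult abs_minus_commute)
    also have "\<dots> \<le> (2 * h) * (r / sqrt (c - r\<^sup>2))"
      using bound[of y] y x h by (intro mult_mono) auto
    finally show ?thesis .
  qed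
qed

lemma minimizers_uniform_limit:
  fixes h r :: real and cs :: "nat \<Rightarrow> real"
  assumes hyp: "h > 0" "r > 0" "h / r \<le> omega" and cs: "filterlim cs at_top sequentially"
    and m: "\<And>j. cs j \<ge> 0 \<and> is_minimizer h r (cs j) (\<rho>s j)"
  shows "uniform_limit {-h..h} \<rho>s (\<lambda>_. r) sequentially"
proof (rule uniform_limitI)
  fix e :: real assume e: "e > 0"
  \<comment> \<open>Beyond \<open>K\<close> the bound \<open>2 * h * (r / sqrt (c - r^2))\<close> of
    \<open>extremal_near_r\<close> is below \<open>e\<close>.\<close>
  define K where "K = r\<^sup>2 + (2 * h * r / e)\<^sup>2"
  have "\<forall>\<^sub>F j in sequentially. K < cs j"
    using cs by (simp add: filterlim_at_top_dense)
  then show "\<forall>\<^sub>F j in sequentially. \<forall>x\<in>{-h..h}. dist (\<rho>s j x) r < e"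
  proof (rule eventually_mono, intro ballI)
    fix j x assume j: "K < cs j" and x: "x \<in> {-h..h}"
    obtain a where a: "0 < a" "a < r" "transit (cs j) a r = h"
      "\<And>x. x \<in> {-h..h} \<Longrightarrow> \<rho>s j x = extremal (cs j) a x"
      using minimizer_eq_extremal[OF hyp, of "cs j" "\<rho>s j"] m[of j] by metis
    have cr: "r\<^sup>2 < cs j" "(2 * h * r / e)\<^sup>2 < cs j - r\<^sup>2"
      using j by (auto simp: K_def intro: le_less_trans[rotated])
    have pos: "2 * h * r / e > 0" using hyp e by simp
    have "2 * h * r / e < sqrt (cs j - r\<^sup>2)" using cr(2) by (rule real_less_rsqrt)
    then have "2 * h * (r / sqrt (cs j - r\<^sup>2)) < e"
      using e cr(1) by (simp add: field_simps)
    then show "dist (\<rho>s j x) r < e"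
      using extremal_near_r[OF cr(1) a(1,2) hyp(1) a(3) x] a(4)[OF x] by (simp add: dist_real_def)
  qed
qed

theorem theorem1p1:
  fixes h r :: real
  assumes "h > 0" and "r > 0" and "h / r \<le> omega"
  shows "(\<forall>c\<ge>0. \<exists>\<rho>. is_minimizer h r c \<rho>)
    \<and> (\<forall>c \<rho>. c \<ge> 0 \<and> is_minimizer h r c \<rho> \<longrightarrow>
         (\<forall>x\<in>{-h..h}. \<rho> (-x) = \<rho> x)
       \<and> strictly_convex_on {-h..h} \<rho>
       \<and> (c > 0 \<longrightarrow> (\<forall>x\<in>{-h<..<h}. rho0 h r x < \<rho> x \<and> \<rho> x < r))
       \<and> (\<exists>\<rho>1 \<rho>2.
            (\<forall>x\<in>{-h..h}. (\<rho> has_real_derivative \<rho>1 x) (at x within {-h..h}))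
          \<and> (\<forall>x\<in>{-h..h}. (\<rho>1 has_real_derivative \<rho>2 x) (at x within {-h..h}))
          \<and> continuous_on {-h..h} \<rho>2
          \<and> (\<forall>x\<in>{-h..h}.
               (1 + (\<rho>1 x)\<^sup>2) * ((c + (\<rho> x)\<^sup>2) * (\<rho>1 x)\<^sup>2 + (\<rho> x)\<^sup>2)
               = \<rho> x * \<rho>2 x * ((\<rho> x)\<^sup>2 * (\<rho>1 x)\<^sup>2 + c * (2 - (\<rho>1 x)\<^sup>2) + (\<rho> x)\<^sup>2))
          \<and> (\<forall>x\<in>{-h..h}.
               c * (\<rho>1 x)\<^sup>2 / (\<rho> x * (1 + (\<rho>1 x)\<^sup>2) powr (3/2))
               - \<rho> x / sqrt (1 + (\<rho>1 x)\<^sup>2) = - \<rho> 0)))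
    \<and> (\<forall>cs :: nat \<Rightarrow> real. \<forall>\<rho>s :: nat \<Rightarrow> real \<Rightarrow> real.
         filterlim cs at_top sequentially \<and> (\<forall>j. cs j \<ge> 0 \<and> is_minimizer h r (cs j) (\<rho>s j))
         \<longrightarrow> uniform_limit {-h..h} \<rho>s (\<lambda>_. r) sequentially)"
    (is "?existence \<and> (\<forall>c \<rho>. _ \<longrightarrow> ?properties c \<rho>) \<and> ?limit")
proof (intro conjI)
  show ?existence
    using val_minimum_exists[OF assms] extremal_is_minimizer assms(1) by metis
  show ?limit
    using minimizers_uniform_limit[OF assms] by blast
  have props: "?properties c \<rho>" if c: "c \<ge> 0" and m: "is_minimizer h r c \<rho>" for c \<rho>
  proof -
    obtain a where a: "0 < a" "a < r" "transit c a r = h"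
      and min: "\<And>b. 0 < b \<Longrightarrow> b \<le> r \<Longrightarrow> val h r c a \<le> val h r c b"
      and eq: "\<And>x. x \<in> {-h..h} \<Longrightarrow> \<rho> x = extremal c a x"
      using minimizer_eq_extremal[OF assms c m] by metis
    note E = c a(1) assms(1) a(2,3)
    define q where "q = pos_inv c a"
    have rng: "\<bar>x\<bar> \<le> pos c a (slope c a r)" if "x \<in> {-h..h}" for x
      by (rule in_range[OF E that])
    have ht: "\<rho> x = ht c a (q x)" if "x \<in> {-h..h}" for x
      using eq[OF that] by (simp add: extremal_def q_def)
    have qd: "(q has_real_derivative 1 / speed c a (q x)) (at x)" if "x \<in> {-h..h}" for x
      unfolding q_def by (rule pos_inv_has_derivative[OF c a(1) rng[OF that] slope_r[OF E]])
    have "\<forall>x\<in>{-h..h}. \<rho> (- x) = \<rho> x"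
      using eq extremal_even[OF E] by simp
    moreover have "strictly_convex_on {-h..h} \<rho>"
      unfolding strictly_convex_on_def
    proof (intro ballI allI impI)
      fix x y t :: real
      assume x: "x \<in> {-h..h}" and y: "y \<in> {-h..h}" and t: "x \<noteq> y \<and> 0 < t \<and> t < 1"
      have "t *\<^sub>R x + (1 - t) *\<^sub>R y \<in> {-h..h}"
        by (rule convexD[OF convex_real_interval(5) x y]) (use t in auto)
      then have z: "t * x + (1 - t) * y \<in> {-h..h}" by simp
      show "\<rho> (t * x + (1 - t) * y) < t * \<rho> x + (1 - t) * \<rho> y"
        unfolding eq[OF x] eq[OF y] eq[OF z]
        using extremal_strictly_convex[OF E] x y t unfolding strictly_convex_on_def by blast
    qed
    moreover have "\<forall>x\<in>{-h<..<h}. rho0 h r x < \<rho> x \<and> \<rho> x < r" if c0: "c > 0"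
    proof
      fix x assume x: "x \<in> {-h<..<h}"
      note P = transit_Pi0[OF assms]
      have "Pi0 h r < a"
        by (rule val_minimizer_gt_Pi0[OF assms c0 a(1) less_imp_le[OF a(2)] min])
      then show "rho0 h r x < \<rho> x \<and> \<rho> x < r"
        using catenary_less_extremal[OF c0 a(1,2) assms(1) a(3) P(2) _ P(1) x]
          extremal_less[OF c a(1,2) assms(1) a(3) x] eq[of x] x by simp
    qed
    moreover have "\<exists>\<rho>1 \<rho>2.
            (\<forall>x\<in>{-h..h}. (\<rho> has_real_derivative \<rho>1 x) (at x within {-h..h}))
          \<and> (\<forall>x\<in>{-h..h}. (\<rho>1 has_real_derivative \<rho>2 x) (at x within {-h..h}))
          \<and> continuous_on {-h..h} \<rho>2
          \<and> (\<forall>x\<in>{-h..h}.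
               (1 + (\<rho>1 x)\<^sup>2) * ((c + (\<rho> x)\<^sup>2) * (\<rho>1 x)\<^sup>2 + (\<rho> x)\<^sup>2)
               = \<rho> x * \<rho>2 x * ((\<rho> x)\<^sup>2 * (\<rho>1 x)\<^sup>2 + c * (2 - (\<rho>1 x)\<^sup>2) + (\<rho> x)\<^sup>2))
          \<and> (\<forall>x\<in>{-h..h}.
               c * (\<rho>1 x)\<^sup>2 / (\<rho> x * (1 + (\<rho>1 x)\<^sup>2) powr (3/2))
               - \<rho> x / sqrt (1 + (\<rho>1 x)\<^sup>2) = - \<rho> 0)"
    \<comment> \<open>The first derivative is the slope \<open>q\<close>; the second is
      \<open>dp/dx\<close>, the reciprocal of \<open>dx/dp = speed\<close>.\<close>
    proof (rule exI[of _ q], rule exI[of _ "\<lambda>x. 1 / speed c a (q x)"], intro conjI ballI)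
      fix x assume x: "x \<in> {-h..h}"
      have "(extremal c a has_real_derivative q x) (at x within {-h..h})"
        unfolding q_def
        by (rule has_field_derivative_at_within[OF extremal_has_derivative[OF c a(1) rng[OF x] slope_r[OF E]]])
      then show "(\<rho> has_real_derivative q x) (at x within {-h..h})"
        unfolding has_field_derivative_def by (rule has_derivative_transform[OF x, rotated]) (rule eq)
      show "(q has_real_derivative 1 / speed c a (q x)) (at x within {-h..h})"
        by (rule has_field_derivative_at_within[OF qd[OF x]])
      show "(1 + (q x)\<^sup>2) * ((c + (\<rho> x)\<^sup>2) * (q x)\<^sup>2 + (\<rho> x)\<^sup>2)
          = \<rho> x * (1 / speed c a (q x)) * ((\<rho> x)\<^sup>2 * (q x)\<^sup>2 + c * (2 - (q x)\<^sup>2) + (\<rho> x)\<^sup>2)"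
        unfolding ht[OF x] by (rule euler_lagrange_identity[OF c a(1)])
      have "\<rho> 0 = a" using eq[of 0] extremal_0[OF E] assms(1) by simp
      then show "c * (q x)\<^sup>2 / (\<rho> x * (1 + (q x)\<^sup>2) powr (3/2)) - \<rho> x / sqrt (1 + (q x)\<^sup>2) = - \<rho> 0"
        unfolding ht[OF x] by (simp add: first_integral_powr[OF c a(1)])
    next
      have "continuous_on {-h..h} q"
        by (rule DERIV_continuous_on) (rule has_field_derivative_at_within[OF qd])
      then have "continuous_on {-h..h} (\<lambda>x. speed c a (q x))"
        by (rule continuous_on_compose2[OF continuous_on_speed[OF c a(1), of UNIV]]) simp
      then show "continuous_on {-h..h} (\<lambda>x. 1 / speed c a (q x))"
        by (rule continuous_on_divide[OF continuous_on_const])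
           (use speed_pos[OF c a(1)] in \<open>simp add: less_imp_neq[symmetric]\<close>)
    qed
    ultimately show ?thesis by simp
  qed
  show "\<forall>c \<rho>. c \<ge> 0 \<and> is_minimizer h r c \<rho> \<longrightarrow> ?properties c \<rho>"
    by (intro allI impI, elim conjE) (rule props)
qed

end
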